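(* Let $T>0$ and let $(S(t,dy))_{t\ge 0}$ be a family of non-negative measures on $\mathbb{R}^d$ such that: (A) $\sup_{t\in[0,T']} S(t,\mathbb{R}^d)<\infty$ for all $T'>0$; (B) there is a jointly measurable $\mathbb{R}^d$-valued process $(\tilde X_t,\ t>0)$ such that for each $t>0$, $P\{-\tilde X_t\in dx\}=S(t,dx)/S(t,\mathbb{R}^d)$. Let $V$ and $w$ be bounded measurable real functions on $[0,T]\times\mathbb{R}^d$. Let $X$, $N$, $(\tau_i)$ and $E_x$ be the process, rate one Poisson process, jump times and expectation constructed from $\tilde X$ as in the context. Then the function $(u(t,x),\ t\le T,\ x\in\mathbb{R}^d)$ defined by $$u(t,x)=e^t\,E_x\left[w\left(t-\tau_{N(t)},X_{\tau_{N(t)}}\right)\prod_{i=1}^{N(t)}\Big[S(\tau_i-\tau_{i-1},\mathbb{R}^d)\,V(t-\tau_i,X_{\tau_i})\Big]\right]$$ (where on $\{N(t)=0\}$ the product is defined to be $1$) is the solution of the integral equation $$u(t,x)=w(t,x)+\int_0^t ds\int_{\mathbb{R}^d}S(s,dy)\,V(t-s,x-y)\,u(t-s,x-y),\qquad t\in[0,T],\ x\in\mathbb{R}^d.$$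
   Context: The kernel $t\mapsto S(t,dy)$ is understood to depend measurably on $t$, and $S(t,\mathbb{R}^d)>0$ for $t>0$, so that the integrals and the law in (B) make sense. "The solution" of the integral equation means the unique solution $u$ with $\sup_{t\le T,\,x\in\mathbb{R}^d}|u(t,x)|^2<\infty$. Construction of $X$. Let $\tilde X^{(i)}=(\tilde X^{(i)}_t)$, $i\ge1$, be i.i.d. copies of $(\tilde X_t)$, and let $(N(t),\ t\ge0)$ be a rate one Poisson process independent of all the $\tilde X^{(i)}$, with jump times $0<\tau_1<\tau_2<\cdots$; set $\tau_0=0$. Define $X=(X_t,\ t\ge0)$ by $X_t=X_0+\tilde X^{(1)}_t$ for $0\le t\le\tau_1$ (the value at $t=0$ being $X_0$) and, for $i\ge1$, $X_t=X_{\tau_i}+\tilde X^{(i+1)}_{t-\tau_i}$ for $\tau_i<t\le\tau_{i+1}$. $P_x$ is a probability under which, in addition, $X_0=x$ with probability one, and $E_x$ is the corresponding expectation.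
   Formalization: The i.i.d. copies and N are taken to be carried by mutually independent sigma-algebras, each copy being jointly measurable with respect to its own (as on a product space); independence of the coordinates alone would allow a copy altered at a jump time of N, for which the claim fails. *)

theory Defs
  imports "HOL-Probability.Probability"
begin

definition jointly_measurable_process ::
    "'w measure \<Rightarrow> (real \<Rightarrow> 'w \<Rightarrow> real ^ 'd) \<Rightarrow> bool" where
  "jointly_measurable_process M X \<longleftrightarrow>
     (\<lambda>(t, \<omega>). X t \<omega>) \<in> borel_measurable (restrict_space borel {0<..} \<Otimes>\<^sub>M M)"

definition process_law ::
    "'w measure \<Rightarrow> (real \<Rightarrow> 'w \<Rightarrow> real ^ 'd) \<Rightarrow> (real \<Rightarrow> real ^ 'd) measure" where
  "process_law M X =
     distr M (\<Pi>\<^sub>M t\<in>{0<..}. borel) (\<lambda>\<omega>. \<lambda>t\<in>{0<..}. X t \<omega>)"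

definition poisson_process :: "'w measure \<Rightarrow> real \<Rightarrow> (real \<Rightarrow> 'w \<Rightarrow> nat) \<Rightarrow> bool" where
  "poisson_process M r N \<longleftrightarrow>
     (\<forall>t\<ge>0. N t \<in> measurable M (count_space UNIV)) \<and>
     (\<forall>\<omega>\<in>space M. N 0 \<omega> = 0 \<and> mono_on {0..} (\<lambda>t. N t \<omega>)) \<and>
     (\<forall>s t. 0 \<le> s \<and> s < t \<longrightarrow>
        distr M (count_space UNIV) (\<lambda>\<omega>. N t \<omega> - N s \<omega>) = measure_pmf (poisson_pmf (r * (t - s)))) \<and>
     (\<forall>(n::nat) ts. 0 \<le> ts 0 \<and> strict_mono ts \<longrightarrow>
        prob_space.indep_vars M (\<lambda>_. count_space UNIV)
          (\<lambda>i \<omega>. N (ts (Suc i)) \<omega> - N (ts i) \<omega>) {..<n})"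

text \<open>\<open>\<tau> 1 < \<tau> 2 < \<dots>\<close> are the jump times of the counting process \<open>N\<close> (all jumps being of
  size one), and \<open>\<tau> 0 = 0\<close>.\<close>

definition jump_times :: "'w set \<Rightarrow> (real \<Rightarrow> 'w \<Rightarrow> nat) \<Rightarrow> (nat \<Rightarrow> 'w \<Rightarrow> real) \<Rightarrow> bool" where
  "jump_times W N \<tau> \<longleftrightarrow>
     (\<forall>\<omega>\<in>W. \<tau> 0 \<omega> = 0 \<and> strict_mono (\<lambda>i. \<tau> i \<omega>) \<and>
        (\<forall>t\<ge>0. finite {i. 1 \<le> i \<and> \<tau> i \<omega> \<le> t} \<and> N t \<omega> = card {i. 1 \<le> i \<and> \<tau> i \<omega> \<le> t}))"

text \<open>Under \<open>M\<close>, the processes \<open>Xc 1, Xc 2, \<dots>\<close> are i.i.d. copies of the process \<open>Y\<close> living on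
  \<open>M0\<close>, and \<open>N\<close> is independent of all of them. The index \<open>0\<close> of the independent
  sub-sigma-algebras \<open>F\<close> is the one carrying \<open>N\<close>.

  Each copy is required to be jointly measurable with respect to its own \<open>F i\<close>. Joint
  measurability on \<open>M\<close> together with independence of the sigma-algebras generated by the
  coordinates \<open>Xc i t\<close> would not suffice to evaluate a copy at an independent random time: if
  \<open>\<sigma>\<close> has a continuous law, the process that is \<open>1\<close> at time \<open>\<sigma>\<close> and \<open>0\<close> elsewhere is jointly
  measurable and its coordinates generate a trivial sigma-algebra, hence one independent of
  \<open>\<sigma>\<close>. For copies on a product space, \<open>F i\<close> is generated by the \<open>i\<close>-th projection.\<close>

definition iid_copies_indep_of ::
    "'w measure \<Rightarrow> 'o measure \<Rightarrow> (real \<Rightarrow> 'o \<Rightarrow> real ^ 'd) \<Rightarrow>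
     (nat \<Rightarrow> real \<Rightarrow> 'w \<Rightarrow> real ^ 'd) \<Rightarrow> (real \<Rightarrow> 'w \<Rightarrow> nat) \<Rightarrow> bool" where
  "iid_copies_indep_of M M0 Y Xc N \<longleftrightarrow>
     (\<exists>F :: nat \<Rightarrow> 'w measure.
        (\<forall>i. subalgebra M (F i)) \<and>
        prob_space.indep_sets M (\<lambda>i. sets (F i)) UNIV \<and>
        (\<forall>t\<ge>0. N t \<in> measurable (F 0) (count_space UNIV)) \<and>
        (\<forall>i\<ge>1. jointly_measurable_process (F i) (Xc i) \<and>
                process_law M (Xc i) = process_law M0 Y))"

text \<open>Since \<open>\<tau> 0 = 0\<close>, the case \<open>i = 0\<close> is the defining relation on the first interval.\<close>

definition concatenated_at ::
    "'w set \<Rightarrow> (nat \<Rightarrow> 'w \<Rightarrow> real) \<Rightarrow> (nat \<Rightarrow> real \<Rightarrow> 'w \<Rightarrow> real ^ 'd) \<Rightarrow>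
     (real \<Rightarrow> 'w \<Rightarrow> real ^ 'd) \<Rightarrow> bool" where
  "concatenated_at W \<tau> Xc X \<longleftrightarrow>
     (\<forall>\<omega>\<in>W. \<forall>i. \<forall>t. \<tau> i \<omega> < t \<and> t \<le> \<tau> (Suc i) \<omega> \<longrightarrow>
        X t \<omega> = X (\<tau> i \<omega>) \<omega> + Xc (Suc i) (t - \<tau> i \<omega>) \<omega>)"

definition bounded_solution ::
    "real \<Rightarrow> (real \<Rightarrow> (real ^ 'd) measure) \<Rightarrow> (real \<Rightarrow> real ^ 'd \<Rightarrow> real) \<Rightarrow>
     (real \<Rightarrow> real ^ 'd \<Rightarrow> real) \<Rightarrow> (real \<Rightarrow> real ^ 'd \<Rightarrow> real) \<Rightarrow> bool" where
  "bounded_solution T S V w u \<longleftrightarrow>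
     (\<lambda>(t, x). u t x) \<in> borel_measurable (restrict_space borel {0..T} \<Otimes>\<^sub>M borel) \<and>
     bdd_above ((\<lambda>(t, x). \<bar>u t x\<bar>\<^sup>2) ` ({0..T} \<times> UNIV)) \<and>
     (\<forall>t\<in>{0..T}. \<forall>x.
        u t x = w t x +
          (LINT s:{0..t}|lborel. (LINT y|S s. V (t - s) (x - y) * u (t - s) (x - y))))"

definition the_bounded_solution ::
    "real \<Rightarrow> (real \<Rightarrow> (real ^ 'd) measure) \<Rightarrow> (real \<Rightarrow> real ^ 'd \<Rightarrow> real) \<Rightarrow>
     (real \<Rightarrow> real ^ 'd \<Rightarrow> real) \<Rightarrow> (real \<Rightarrow> real ^ 'd \<Rightarrow> real) \<Rightarrow> bool" where
  "the_bounded_solution T S V w u \<longleftrightarrow>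
     bounded_solution T S V w u \<and>
     (\<forall>v. bounded_solution T S V w v \<longrightarrow> (\<forall>t\<in>{0..T}. \<forall>x. v t x = u t x))"

end

theory Submission
  imports Defs
begin

text \<open>
  The integral equation has the form \<open>u = w + K u\<close>, where \<open>K\<close> is linear and only looks into the
  past: with \<open>m s\<close> the total mass of \<open>S s\<close>, the integrand of \<open>K h\<close> at time \<open>r\<close> involves \<open>h\<close> at the
  times \<open>r - s\<close> with \<open>0 < s \<le> r\<close>. A Volterra operator of this kind satisfies
  \<open>\<bar>(K ^^ n) h r z\<bar> \<le> B * (C * r) ^ n / n!\<close> for bounded \<open>h\<close> (lemma \<open>iterate_bound\<close>). Hence the
  Neumann series \<open>\<Sum>n. (K ^^ n) w\<close> converges uniformly on \<open>[0, T]\<close> to a bounded solution, and the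
  difference of two bounded solutions, being a fixed point of \<open>K\<close>, vanishes
  (\<open>solution_fixed_point\<close>, \<open>solution_unique\<close>).

  It remains to recognise the part of the expectation that lives on \<open>{N(t) = n}\<close> as
  \<open>exp (- t) * (K ^^ n) w t x\<close>. The waiting time \<open>\<tau>(n+1) - \<tau>(n)\<close> is exponential with parameter one
  and independent of everything that determines the walk up to its \<open>n\<close>-th jump (\<open>prob_gap_tail\<close>,
  \<open>gap_indep_history\<close>), and the \<open>(n+1)\<close>-st copy of the process is independent of both
  (\<open>next_step_integral\<close>). Let \<open>Z n\<close> be the product of the first \<open>n\<close> factors. Integrating out the
  waiting time after the \<open>n\<close>-th jump, which has to exceed \<open>t - \<tau>(n)\<close>, turns the indicator of
  \<open>{N(t) = n}\<close> into \<open>exp (\<tau>(n) - t)\<close>. Now consider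
  \<open>E [exp (\<tau>(n)) * h (t - \<tau>(n)) (X at \<tau>(n)) * Z n]\<close>. Integrating out the last waiting time \<open>s\<close>
  and the last displacement, the density \<open>exp (- s)\<close> cancels against the growth of \<open>exp (\<tau>(n))\<close>, and
  what is left is the same expression with \<open>n - 1\<close> in place of \<open>n\<close> and \<open>K h\<close> in place of \<open>h\<close>
  (\<open>moment_Suc\<close>). After \<open>n\<close> such steps only \<open>(K ^^ n) h t x\<close> remains.

  The independence of the waiting time is the strong Markov property of the Poisson process at
  \<open>\<tau>(n)\<close>. It is obtained by rounding \<open>\<tau>(n)\<close> up to a grid, using independence of increments at each
  grid point, and refining the grid.
\<close>

section \<open>Waiting times of a marked Poisson process\<close>

text \<open>Enlarging one of two independent families \<open>A\<close>, \<open>B\<close> by information \<open>C\<close> that is independent of both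
  jointly keeps them independent: the sets \<open>a \<inter> c\<close> form a generator that is stable under
  intersection, and on it the probabilities factor.\<close>

lemma (in prob_space) indep_set_adjoin:
  assumes AB: "indep_set A B" and DC: "indep_set D C"
    and sub: "A \<subseteq> D" "B \<subseteq> D"
    and stable: "Int_stable A" "Int_stable B" "Int_stable C" "Int_stable D"
    and sp: "space M \<in> A" "space M \<in> C"
  shows "indep_set (sigma_sets (space M) (A \<union> C)) (sigma_sets (space M) B)"
proof -
  define Q where "Q = {a \<inter> c | a c. a \<in> A \<and> c \<in> C}"
  have ev: "A \<subseteq> events" "B \<subseteq> events" "C \<subseteq> events" "D \<subseteq> events"
    using AB DC by (auto simp: indep_sets2_eq)
  have "indep_set Q B"
    unfolding indep_sets2_eq
  proof (intro conjI ballI)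
    show "Q \<subseteq> events" "B \<subseteq> events" using ev by (auto simp: Q_def)
    fix q b assume "q \<in> Q" and b: "b \<in> B"
    then obtain a c where q: "q = a \<inter> c" and a: "a \<in> A" and c: "c \<in> C" by (auto simp: Q_def)
    have "a \<in> D" "b \<in> D" "a \<inter> b \<in> D"
      using a b sub stable(4) by (auto simp: Int_stable_def)
    then have "prob (a \<inter> b \<inter> c) = prob (a \<inter> b) * prob c" "prob (a \<inter> c) = prob a * prob c"
      using DC c by (auto simp: indep_sets2_eq)
    moreover have "prob (a \<inter> b) = prob a * prob b" using AB a b by (auto simp: indep_sets2_eq)
    moreover have "q \<inter> b = a \<inter> b \<inter> c" by (auto simp: q)
    ultimately show "prob (q \<inter> b) = prob q * prob b" by (simp add: q)
  qed
  moreover have "Int_stable Q"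
  proof (rule Int_stableI)
    fix p q assume "p \<in> Q" "q \<in> Q"
    then obtain a c a' c' where pq: "p = a \<inter> c" "q = a' \<inter> c'"
      and mem: "a \<in> A" "a' \<in> A" "c \<in> C" "c' \<in> C"
      by (auto simp: Q_def)
    have "a \<inter> a' \<in> A" "c \<inter> c' \<in> C"
      using mem stable(1,3) by (simp_all add: Int_stable_def)
    moreover have "p \<inter> q = (a \<inter> a') \<inter> (c \<inter> c')" by (auto simp: pq)
    ultimately show "p \<inter> q \<in> Q" by (auto simp: Q_def)
  qed
  ultimately have "indep_set (sigma_sets (space M) Q) (sigma_sets (space M) B)"
    by (rule indep_set_sigma_sets[OF _ _ stable(2)])
  moreover have "sigma_sets (space M) (A \<union> C) \<subseteq> sigma_sets (space M) Q"
  proof (rule sigma_sets_mono)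
    have "a \<in> Q" if "a \<in> A" for a
    proof -
      have "a = a \<inter> space M" using that ev sets.sets_into_space[of a M] by auto
      then show ?thesis using that sp by (auto simp: Q_def)
    qed
    moreover have "c \<in> Q" if "c \<in> C" for c
    proof -
      have "c = space M \<inter> c" using that ev sets.sets_into_space[of c M] by auto
      then show ?thesis using that sp by (auto simp: Q_def)
    qed
    ultimately show "A \<union> C \<subseteq> sigma_sets (space M) Q" by auto
  qed
  ultimately show ?thesis unfolding indep_sets2_eq by blast
qed

text \<open>Finite-dimensional events of a counting process. Allowing \<open>D\<close> to be arbitrary off \<open>R\<close> makes
  these sets stable under intersection without any bookkeeping about the times involved.\<close>

definition cylinder :: "'w set \<Rightarrow> (real \<Rightarrow> 'w \<Rightarrow> nat) \<Rightarrow> real set \<Rightarrow> (real \<Rightarrow> nat set) \<Rightarrow> 'w set"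
  where "cylinder W N R D = {\<omega>\<in>W. \<forall>r\<in>R. N r \<omega> \<in> D r}"

lemma cylinder_Int:
  "cylinder W N R D \<inter> cylinder W N R' D' =
     cylinder W N (R \<union> R') (\<lambda>r. (if r \<in> R then D r else UNIV) \<inter> (if r \<in> R' then D' r else UNIV))"
  by (auto simp: cylinder_def)

text \<open>Independence of increments is given along strictly increasing sequences of times. The finitely
  many times in \<open>R\<close>, together with \<open>0\<close> and \<open>u\<close>, are sorted into such a sequence, continued by
  \<open>u + s\<close>. Every \<open>N r\<close> with \<open>r \<in> R\<close> is then a sum of increments before the one from \<open>u\<close> to
  \<open>u + s\<close>, because \<open>N 0 = 0\<close>.\<close>

lemma (in prob_space) poisson_increment_indep_cylinder:
  assumes N: "poisson_process M r N" and u: "0 \<le> u" and s: "0 < s"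
    and R: "finite R" "R \<subseteq> {0..u}"
  shows "prob (cylinder (space M) N R D \<inter> {\<omega>\<in>space M. N (u + s) \<omega> - N u \<omega> \<in> B}) =
         prob (cylinder (space M) N R D) * prob {\<omega>\<in>space M. N (u + s) \<omega> - N u \<omega> \<in> B}"
proof -
  have zero: "N 0 \<omega> = 0" and mono: "\<And>p q. 0 \<le> p \<Longrightarrow> p \<le> q \<Longrightarrow> N p \<omega> \<le> N q \<omega>"
    if "\<omega> \<in> space M" for \<omega>
    using N that unfolding poisson_process_def mono_on_def by auto
  define R' where "R' = insert 0 (insert u R)"
  have R': "finite R'" "R' \<subseteq> {0..u}" "0 \<in> R'" "u \<in> R'" "R \<subseteq> R'"
    using R u by (auto simp: R'_def)
  define l where "l = sorted_list_of_set R'"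
  have l: "sorted_wrt (<) l" "set l = R'" using R'(1) by (auto simp: l_def)
  define k where "k = length l - 1"
  have len: "length l = Suc k" using R'(3) l(2) by (cases l) (auto simp: k_def)
  have mono_l: "l ! i < l ! j" if "i < j" "j \<le> k" for i j
    using sorted_wrt_nth_less[OF l(1), of i j] that len by simp
  have in_l: "l ! i \<in> R'" if "i \<le> k" for i using that len l(2) nth_mem[of i l] by auto
  have l0: "l ! 0 = 0"
  proof -
    obtain j where "j \<le> k" "l ! j = 0" using R'(3) l(2) len by (metis in_set_conv_nth less_Suc_eq_le)
    then show ?thesis using mono_l[of 0 j] in_l[of 0] R'(2) by (cases j) auto
  qed
  have lk: "l ! k = u"
  proof -
    obtain j where j: "j \<le> k" "l ! j = u" using R'(4) l(2) len by (metis in_set_conv_nth less_Suc_eq_le)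
    show ?thesis using mono_l[of j k] in_l[of k] R'(2) j by (cases "j = k") force+
  qed
  \<comment> \<open>Past the last element \<open>u\<close> of the list the sequence continues with step \<open>s\<close>, so that the increment number \<open>k\<close> is the one from \<open>u\<close> to \<open>u + s\<close>.\<close>
  define ts where "ts i = (if i \<le> k then l ! i else u + s * real (i - k))" for i
  have ts: "ts 0 = 0" "ts k = u" "ts (Suc k) = u + s" using l0 lk by (auto simp: ts_def)
  have smono: "strict_mono ts"
  proof (rule strict_monoI_Suc)
    fix i show "ts i < ts (Suc i)"
    proof (cases "i < k")
      case True then show ?thesis using mono_l[of i "Suc i"] by (simp add: ts_def)
    next
      case False
      then show ?thesis using lk s by (auto simp: ts_def not_less Suc_diff_le algebra_simps)
    qed
  qed
  define Z where "Z i \<omega> = N (ts (Suc i)) \<omega> - N (ts i) \<omega>" for i \<omega>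
  have "indep_vars (\<lambda>_. count_space UNIV) Z {..<Suc k}"
    using N smono ts(1) unfolding poisson_process_def Z_def by auto
  then have "indep_var (PiM {..<k} (\<lambda>_. count_space UNIV)) (\<lambda>\<omega>. restrict (\<lambda>i. Z i \<omega>) {..<k})
               (PiM {k} (\<lambda>_. count_space UNIV)) (\<lambda>\<omega>. restrict (\<lambda>i. Z i \<omega>) {k})"
    by (rule indep_var_restrict) auto
  then have iv: "indep_var (count_space ({..<k} \<rightarrow>\<^sub>E UNIV)) (\<lambda>\<omega>. restrict (\<lambda>i. Z i \<omega>) {..<k})
               (count_space ({k} \<rightarrow>\<^sub>E UNIV)) (\<lambda>\<omega>. restrict (\<lambda>i. Z i \<omega>) {k})"
    by (simp add: count_space_PiM_finite)
  have tele: "N (ts j) \<omega> = (\<Sum>i<j. Z i \<omega>)" if "\<omega> \<in> space M" for j \<omega>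
  proof (induction j)
    case 0 then show ?case using zero that ts by simp
  next
    case (Suc j)
    have "0 \<le> ts j" "ts j \<le> ts (Suc j)"
      using smono ts(1) strict_mono_less_eq[OF smono, of 0 j] strict_mono_less_eq[OF smono, of j "Suc j"] by auto
    then have "N (ts j) \<omega> \<le> N (ts (Suc j)) \<omega>" using mono that by auto
    then show ?case using Suc by (simp add: Z_def)
  qed
  have "\<forall>r\<in>R. \<exists>j\<le>k. ts j = r"
    using R'(5) l(2) len by (metis in_set_conv_nth less_Suc_eq_le subset_iff ts_def)
  then obtain ix where ix: "\<And>r. r \<in> R \<Longrightarrow> ix r \<le> k \<and> ts (ix r) = r" by metis
  define A where "A = {d \<in> {..<k} \<rightarrow>\<^sub>E UNIV. \<forall>r\<in>R. (\<Sum>i<ix r. d i) \<in> D r}"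
  define B' where "B' = {d \<in> {k} \<rightarrow>\<^sub>E (UNIV::nat set). d k \<in> B}"
  have sumeq: "(\<Sum>i<ix r. restrict (\<lambda>i. Z i \<omega>) {..<k} i) = N r \<omega>" if "r \<in> R" "\<omega> \<in> space M" for r \<omega>
    using ix[OF that(1)] tele[OF that(2), of "ix r"] by (auto intro!: sum.cong)
  have cyl: "cylinder (space M) N R D = (\<lambda>\<omega>. restrict (\<lambda>i. Z i \<omega>) {..<k}) -` A \<inter> space M"
    unfolding cylinder_def A_def using sumeq by (auto simp del: restrict_apply)
  have inc: "{\<omega>\<in>space M. N (u + s) \<omega> - N u \<omega> \<in> B} = (\<lambda>\<omega>. restrict (\<lambda>i. Z i \<omega>) {k}) -` B' \<inter> space M"
    by (auto simp: B'_def Z_def ts)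
  have "prob ((\<lambda>x. (restrict (\<lambda>i. Z i x) {..<k}, restrict (\<lambda>i. Z i x) {k})) -` (A \<times> B') \<inter> space M) =
     prob ((\<lambda>\<omega>. restrict (\<lambda>i. Z i \<omega>) {..<k}) -` A \<inter> space M) * prob ((\<lambda>\<omega>. restrict (\<lambda>i. Z i \<omega>) {k}) -` B' \<inter> space M)"
    by (rule indep_varD[OF iv]) (auto simp: A_def B'_def)
  moreover have "(\<lambda>x. (restrict (\<lambda>i. Z i x) {..<k}, restrict (\<lambda>i. Z i x) {k})) -` (A \<times> B') \<inter> space M
     = cylinder (space M) N R D \<inter> {\<omega>\<in>space M. N (u + s) \<omega> - N u \<omega> \<in> B}"
    unfolding cyl inc by auto
  ultimately show ?thesis unfolding cyl inc by simp
qed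

text \<open>The clock \<open>N\<close> is measurable with respect to \<open>F 0\<close>; the sigma-algebras \<open>F 1\<close>, \<open>F 2\<close>, \<dots> carry the
  marks, that is, whatever randomness is attached to the successive waiting times.\<close>

locale marked_clock = prob_space M for M :: "'w measure" +
  fixes F :: "nat \<Rightarrow> 'w measure" and N :: "real \<Rightarrow> 'w \<Rightarrow> nat" and \<tau> :: "nat \<Rightarrow> 'w \<Rightarrow> real"
  assumes subalg: "\<And>i. subalgebra M (F i)"
    and indep_F: "indep_sets (\<lambda>i. sets (F i)) UNIV"
    and N_F0: "\<And>t. 0 \<le> t \<Longrightarrow> N t \<in> measurable (F 0) (count_space UNIV)"
    and poisson: "poisson_process M 1 N"
    and jumps: "jump_times (space M) N \<tau>"
begin

lemma space_F [simp]: "space (F i) = space M"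
  using subalg[of i] by (simp add: subalgebra_def)

lemma sets_F: "A \<in> sets (F i) \<Longrightarrow> A \<in> events"
  using subalg[of i] by (auto simp: subalgebra_def)

lemma UN_F_Pow: "(\<Union>i\<in>I. sets (F i)) \<subseteq> Pow (space M)"
proof (rule UN_least)
  show "sets (F i) \<subseteq> Pow (space M)" for i using sets.space_closed[of "F i"] by simp
qed

lemma \<tau>_0: "\<omega> \<in> space M \<Longrightarrow> \<tau> 0 \<omega> = 0"
  using jumps by (simp add: jump_times_def)

lemma \<tau>_less: "\<omega> \<in> space M \<Longrightarrow> i < j \<Longrightarrow> \<tau> i \<omega> < \<tau> j \<omega>"
  using jumps by (auto simp: jump_times_def strict_mono_def)

lemma \<tau>_mono: "\<omega> \<in> space M \<Longrightarrow> i \<le> j \<Longrightarrow> \<tau> i \<omega> \<le> \<tau> j \<omega>"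
  using \<tau>_less[of \<omega> i j] by (cases "i = j") auto

lemma \<tau>_nonneg: "\<omega> \<in> space M \<Longrightarrow> 0 \<le> \<tau> i \<omega>"
  using \<tau>_mono[of \<omega> 0 i] \<tau>_0 by simp

text \<open>The passage from the counting process to its jump times: since the \<open>\<tau> i\<close> increase, those in
  \<open>[0, t]\<close> are exactly the first \<open>N t\<close> of them.\<close>

lemma \<tau>_le_iff:
  assumes \<omega>: "\<omega> \<in> space M" and t: "0 \<le> t"
  shows "\<tau> n \<omega> \<le> t \<longleftrightarrow> n \<le> N t \<omega>"
proof -
  let ?J = "{i. 1 \<le> i \<and> \<tau> i \<omega> \<le> t}"
  have J: "finite ?J" "N t \<omega> = card ?J"
    using jumps \<omega> t by (auto simp: jump_times_def)
  show ?thesis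
  proof
    assume "\<tau> n \<omega> \<le> t"
    then have "i \<in> ?J" if "i \<in> {1..n}" for i using \<tau>_mono[OF \<omega>, of i n] that by simp
    then have "{1..n} \<subseteq> ?J" by blast
    from card_mono[OF J(1) this] show "n \<le> N t \<omega>" by (simp add: J)
  next
    assume le: "n \<le> N t \<omega>"
    show "\<tau> n \<omega> \<le> t"
    proof (rule ccontr)
      assume n: "\<not> \<tau> n \<omega> \<le> t"
      then have "0 < n" using \<tau>_0[OF \<omega>] t by (cases n) auto
      have "?J \<subseteq> {1..<n}"
      proof
        fix i assume "i \<in> ?J"
        then show "i \<in> {1..<n}" using n \<tau>_mono[OF \<omega>, of n i] by (cases "n \<le> i") auto
      qed
      from card_mono[OF _ this] have "card ?J \<le> n - 1" by simp
      then show False using le J(2) \<open>0 < n\<close> by simp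
    qed
  qed
qed

lemma N_eq_iff:
  assumes "\<omega> \<in> space M" "0 \<le> t"
  shows "N t \<omega> = n \<longleftrightarrow> \<tau> n \<omega> \<le> t \<and> t < \<tau> (Suc n) \<omega>"
  using \<tau>_le_iff[OF assms, of n] \<tau>_le_iff[OF assms, of "Suc n"] by linarith

lemma \<tau>_F0: "{\<omega>\<in>space M. \<tau> n \<omega> \<le> a} \<in> sets (F 0)"
proof (cases "0 \<le> a")
  case True
  have "{\<omega>\<in>space M. \<tau> n \<omega> \<le> a} = N a -` {n..} \<inter> space (F 0)"
    using \<tau>_le_iff[OF _ True] by auto
  also have "\<dots> \<in> sets (F 0)" by (rule measurable_sets[OF N_F0[OF True]]) simp
  finally show ?thesis .
next
  case False
  then have "{\<omega>\<in>space M. \<tau> n \<omega> \<le> a} = {}" using \<tau>_nonneg[of _ n] by force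
  then show ?thesis by (simp only: sets.empty_sets)
qed

lemma \<tau>_measurable_F0: "\<tau> n \<in> borel_measurable (F 0)"
  by (rule borel_measurableI_le) (simp add: \<tau>_F0)

definition gap :: "nat \<Rightarrow> 'w \<Rightarrow> real"
  where "gap n \<omega> = \<tau> (Suc n) \<omega> - \<tau> n \<omega>"

text \<open>What is known once the \<open>n\<close>-th jump has happened and the first \<open>n\<close> marks have been read. The
  generators \<open>{\<tau> i \<le> a}\<close> are chosen because their traces on \<open>{\<tau> n \<le> u}\<close> are events about the clock up
  to time \<open>u\<close>.\<close>

definition history :: "nat \<Rightarrow> 'w measure"
  where "history n = sigma (space M)
    ((\<Union>i\<in>{1..n}. sets (F i)) \<union> {{\<omega>\<in>space M. \<tau> i \<omega> \<le> a} | i a. i \<le> n})"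

definition marks :: "'w set set"
  where "marks = sigma_sets (space M) (\<Union>i\<in>{1..}. sets (F i))"

definition past :: "real \<Rightarrow> 'w set set"
  where "past u = {cylinder (space M) N R D | R D. finite R \<and> R \<subseteq> {0..u}}"

lemma history_gen:
  "((\<Union>i\<in>{1..n}. sets (F i)) \<union> {{\<omega>\<in>space M. \<tau> i \<omega> \<le> a} | i a. i \<le> n}) \<subseteq> Pow (space M)"
proof (rule Un_least)
  show "(\<Union>i\<in>{1..n}. sets (F i)) \<subseteq> Pow (space M)" by (rule UN_F_Pow)
  show "{{\<omega>\<in>space M. \<tau> i \<omega> \<le> a} | i a. i \<le> n} \<subseteq> Pow (space M)" by blast
qed

lemma space_history [simp]: "space (history n) = space M"
  unfolding history_def by (rule space_measure_of[OF history_gen])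

lemma sets_history:
  "sets (history n) = sigma_sets (space M)
    ((\<Union>i\<in>{1..n}. sets (F i)) \<union> {{\<omega>\<in>space M. \<tau> i \<omega> \<le> a} | i a. i \<le> n})"
  unfolding history_def by (rule sets_measure_of[OF history_gen])

lemma subalg_history: "subalgebra M (history n)"
  unfolding subalgebra_def
proof
  show "sets (history n) \<subseteq> events"
    unfolding sets_history
  proof (rule sets.sigma_sets_subset, intro Un_least subsetI)
    show "A \<in> events" if "A \<in> (\<Union>i\<in>{1..n}. sets (F i))" for A
      using that sets_F by blast
    show "A \<in> events" if "A \<in> {{\<omega>\<in>space M. \<tau> i \<omega> \<le> a} | i a. i \<le> n}" for A
      using that sets_F[OF \<tau>_F0] by blast
  qed
qed simp

lemma \<tau>_history: "i \<le> n \<Longrightarrow> \<tau> i \<in> borel_measurable (history n)"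
  by (rule borel_measurableI_le) (auto simp: sets_history)

lemma F_le_history: "1 \<le> i \<Longrightarrow> i \<le> n \<Longrightarrow> subalgebra (history n) (F i)"
  unfolding subalgebra_def sets_history by (auto intro!: sigma_sets.Basic)

lemma past_subset: "past u \<subseteq> sets (F 0)"
proof
  fix A assume "A \<in> past u"
  then obtain R D where A: "A = cylinder (space M) N R D" and R: "finite R" "R \<subseteq> {0..u}"
    by (auto simp: past_def)
  have [measurable]: "N r \<in> measurable (F 0) (count_space UNIV)" if "r \<in> R" for r
    using R that by (intro N_F0) auto
  have "{\<omega> \<in> space (F 0). \<forall>r\<in>R. N r \<omega> \<in> D r} \<in> sets (F 0)"
    by (rule sets.sets_Collect_finite_All[OF _ R(1)]) measurable
  then show "A \<in> sets (F 0)" by (simp add: A cylinder_def)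
qed

lemma Int_stable_past: "Int_stable (past u)"
proof (rule Int_stableI)
  fix a b assume "a \<in> past u" "b \<in> past u"
  then obtain R D R' D' where ab: "a = cylinder (space M) N R D" "b = cylinder (space M) N R' D'"
    and R: "finite (R \<union> R')" "R \<union> R' \<subseteq> {0..u}" by (auto simp: past_def)
  show "a \<inter> b \<in> past u"
    unfolding past_def ab cylinder_Int using R by blast
qed

lemma space_in_past: "space M \<in> past u"
proof -
  have "space M = cylinder (space M) N {} (\<lambda>_. {})" by (simp add: cylinder_def)
  then show ?thesis unfolding past_def by blast
qed

lemma indep_clock_marks: "indep_set (sets (F 0)) marks"
proof -
  have "indep_sets (\<lambda>b. sigma_sets (space M) (\<Union>i\<in>case_bool {0} {1..} b. sets (F i))) UNIV"
  proof (rule indep_sets_collect_sigma)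
    show "indep_sets (\<lambda>i. sets (F i)) (\<Union>b. case_bool {0} {1..} b)"
      by (rule indep_sets_mono_index[OF subset_UNIV indep_F])
    show "Int_stable (sets (F i))" for i by (rule sets.Int_stable)
    show "disjoint_family (case_bool {0::nat} {1..})"
      by (simp add: disjoint_family_on_def split: bool.split)
  qed
  then have "indep_sets (case_bool (sigma_sets (space M) (sets (F 0))) marks) UNIV"
    by (rule indep_sets_mono_sets) (auto simp: marks_def split: bool.split)
  moreover have "sigma_sets (space M) (sets (F 0)) = sets (F 0)"
    using sets.sigma_sets_eq[of "F 0"] by simp
  ultimately show ?thesis by (simp add: indep_set_def)
qed

lemma prob_no_jump:
  assumes "0 \<le> u" "0 < s"
  shows "prob {\<omega>\<in>space M. N (u + s) \<omega> - N u \<omega> = 0} = exp (- s)"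
proof -
  have [measurable]: "random_variable (count_space UNIV) (N u)" "random_variable (count_space UNIV) (N (u + s))"
    using poisson assms by (auto simp: poisson_process_def)
  have "prob {\<omega>\<in>space M. N (u + s) \<omega> - N u \<omega> = 0}
      = measure (distr M (count_space UNIV) (\<lambda>\<omega>. N (u + s) \<omega> - N u \<omega>)) {0}"
    by (subst measure_distr) (auto intro!: arg_cong[where f=prob])
  also have "\<dots> = measure (measure_pmf (poisson_pmf (1 * (u + s - u)))) {0}"
    using poisson assms unfolding poisson_process_def by auto
  also have "\<dots> = exp (- s)" using assms by (simp add: measure_pmf_single)
  finally show ?thesis .
qed

text \<open>The Markov property of the clock at a fixed time \<open>u\<close>, in the presence of all marks.\<close>

lemma past_marks_indep_no_jump:
  assumes u: "0 \<le> u" and s: "0 < s" and E: "E \<in> sigma_sets (space M) (past u \<union> marks)"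
  shows "prob (E \<inter> {\<omega>\<in>space M. N (u + s) \<omega> - N u \<omega> = 0}) = prob E * exp (- s)"
proof -
  have [measurable]: "N u \<in> measurable (F 0) (count_space UNIV)" "N (u + s) \<in> measurable (F 0) (count_space UNIV)"
    using u s by (auto intro: N_F0)
  let ?B = "{{\<omega>\<in>space M. N (u + s) \<omega> - N u \<omega> \<in> B} | B. True}"
  have BF: "?B \<subseteq> sets (F 0)"
  proof safe
    fix B
    have "{\<omega>\<in>space (F 0). N (u + s) \<omega> - N u \<omega> \<in> B} \<in> sets (F 0)" by measurable
    then show "{\<omega>\<in>space M. N (u + s) \<omega> - N u \<omega> \<in> B} \<in> sets (F 0)" by simp
  qed
  have 1: "indep_set (past u) ?B"
    unfolding indep_sets2_eq
  proof (intro conjI ballI)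
    show "past u \<subseteq> events" "?B \<subseteq> events" using BF past_subset sets_F by blast+
    fix a b assume "a \<in> past u" "b \<in> ?B"
    then show "prob (a \<inter> b) = prob a * prob b"
      unfolding past_def
      using poisson_increment_indep_cylinder[OF poisson u s] by blast
  qed
  have 2: "Int_stable ?B"
  proof (rule Int_stableI)
    fix a b assume "a \<in> ?B" "b \<in> ?B"
    then obtain A' B' where "a = {\<omega>\<in>space M. N (u + s) \<omega> - N u \<omega> \<in> A'}" "b = {\<omega>\<in>space M. N (u + s) \<omega> - N u \<omega> \<in> B'}" by auto
    then show "a \<inter> b \<in> ?B" by (intro CollectI exI[of _ "A' \<inter> B'"]) auto
  qed
  have gen: "(\<Union>i\<in>{1..}. sets (F i)) \<subseteq> Pow (space M)"
    by (rule UN_F_Pow)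
  have marks_eq: "marks = sets (sigma (space M) (\<Union>i\<in>{1..}. sets (F i)))"
    unfolding marks_def by (rule sets_measure_of[OF gen, symmetric])
  have Ms: "Int_stable marks" "space M \<in> marks"
    unfolding marks_eq using sets.top[of "sigma (space M) (\<Union>i\<in>{1..}. sets (F i))"]
    by (auto simp: sets.Int_stable space_measure_of[OF gen])
  have "indep_set (sigma_sets (space M) (past u \<union> marks)) (sigma_sets (space M) ?B)"
    by (rule indep_set_adjoin[OF 1 indep_clock_marks past_subset BF Int_stable_past 2 Ms(1) sets.Int_stable space_in_past Ms(2)])
  moreover have "{\<omega>\<in>space M. N (u + s) \<omega> - N u \<omega> = 0} \<in> sigma_sets (space M) ?B"
    by (rule sigma_sets.Basic) (auto intro!: exI[of _ "{0}"])
  ultimately have "prob (E \<inter> {\<omega>\<in>space M. N (u + s) \<omega> - N u \<omega> = 0}) = prob E * prob {\<omega>\<in>space M. N (u + s) \<omega> - N u \<omega> = 0}"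
    using E by (auto simp: indep_sets2_eq)
  then show ?thesis by (simp only: prob_no_jump[OF u s])
qed

text \<open>The sigma-algebra \<open>history n\<close> is contained in the stopped sigma-algebra at \<open>\<tau> n\<close> of the filtration
  generated by the clock and all marks: on \<open>{\<tau> n \<le> u}\<close> its events are decided by the clock up to time
  \<open>u\<close> and the marks. The sets with this property form a sigma-algebra, so generators suffice.\<close>

lemma history_before:
  assumes u: "0 \<le> u" and E: "E \<in> sets (history n)"
  shows "E \<inter> {\<omega>\<in>space M. \<tau> n \<omega> \<le> u} \<in> sigma_sets (space M) (past u \<union> marks)"
proof -
  have gen: "past u \<union> marks \<subseteq> Pow (space M)"
  proof (rule Un_least)
    show "past u \<subseteq> Pow (space M)"
      using past_subset[of u] sets.space_closed[of "F 0"] by simp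
    have "marks \<subseteq> events" using indep_clock_marks by (simp add: indep_sets2_eq)
    then show "marks \<subseteq> Pow (space M)" using sets.space_closed by (rule order_trans)
  qed
  define G where "G = sigma (space M) (past u \<union> marks)"
  have sets_G: "sets G = sigma_sets (space M) (past u \<union> marks)"
    unfolding G_def by (rule sets_measure_of[OF gen])
  have space_G: "space G = space M" unfolding G_def by (rule space_measure_of[OF gen])
  have before: "{\<omega>\<in>space M. \<tau> i \<omega> \<le> a} \<in> sets G" if "0 \<le> a" "a \<le> u" for i a
  proof -
    have "{\<omega>\<in>space M. \<tau> i \<omega> \<le> a} = cylinder (space M) N {a} (\<lambda>_. {i..})"
      using \<tau>_le_iff[OF _ that(1)] by (auto simp: cylinder_def)
    also have "\<dots> \<in> past u" using that by (auto simp: past_def)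
    finally show ?thesis by (auto simp: sets_G)
  qed
  let ?H = "{\<omega>\<in>space M. \<tau> n \<omega> \<le> u}"
  have H: "?H \<in> sets G" using before u by simp
  have "E \<inter> ?H \<in> sets G"
    using E unfolding sets_history
  proof (induction E rule: sigma_sets.induct)
    case (Basic a)
    then consider i where "1 \<le> i" "a \<in> sets (F i)" | i c where "i \<le> n" "a = {\<omega>\<in>space M. \<tau> i \<omega> \<le> c}"
      by auto
    then show ?case
    proof cases
      case 1
      then have "a \<in> marks" by (auto simp: marks_def)
      then have "a \<in> sets G" by (auto simp: sets_G)
      then show ?thesis using H by (rule sets.Int)
    next
      case 2
      show ?thesis
      proof (cases "0 \<le> c")
        case True
        have "a \<inter> ?H = {\<omega>\<in>space M. \<tau> i \<omega> \<le> min c u} \<inter> ?H"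
          using \<tau>_mono[OF _ 2(1)] by (auto simp: 2(2) intro: order_trans)
        then show ?thesis using before[of "min c u" i] True u H by auto
      next
        case False
        then have "a = {}" using \<tau>_nonneg[of _ i] by (force simp: 2(2))
        then show ?thesis by simp
      qed
    qed
  next
    case (Compl a)
    have "(space M - a) \<inter> ?H = ?H - (a \<inter> ?H)" by auto
    then show ?case using Compl H by auto
  next
    case (Union a)
    have "\<Union> (range a) \<inter> ?H = (\<Union>i. a i \<inter> ?H)" by auto
    also have "\<dots> \<in> sets G" using Union by (intro sets.countable_UN) auto
    finally show ?case .
  qed auto
  then show ?thesis by (simp add: sets_G)
qed

lemma gap_pos: "\<omega> \<in> space M \<Longrightarrow> 0 < gap n \<omega>"
  using \<tau>_less[of \<omega> n "Suc n"] by (simp add: gap_def)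

lemma gap_measurable_F0: "gap n \<in> borel_measurable (F 0)"
  unfolding gap_def using \<tau>_measurable_F0[measurable] by measurable

text \<open>The strong Markov property at \<open>\<tau> n\<close>. The time \<open>\<tau> n\<close> is rounded up to the next point \<open>\<sigma> j\<close> of the
  grid of width \<open>1 / (j + 1)\<close>. On each of the countably many events \<open>\<sigma> j = const\<close> the Markov property at
  a fixed time gives the factor \<open>exp (- s)\<close>. As the grid is refined, the event that there is no jump
  in \<open>(\<sigma> j, \<sigma> j + s]\<close> converges pointwise to \<open>s < gap n\<close>.\<close>

lemma prob_gap_tail:
  assumes E: "E \<in> sets (history n)" and s: "0 < s"
  shows "prob (E \<inter> {\<omega>\<in>space M. s < gap n \<omega>}) = prob E * exp (- s)"
proof -
  have E_ev: "E \<in> events" using E subalg_history by (auto simp: subalgebra_def)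
  have gap_ev: "{\<omega>\<in>space M. s < gap n \<omega>} \<in> events"
  proof -
    have "{\<omega>\<in>space (F 0). s < gap n \<omega>} \<in> sets (F 0)"
      using gap_measurable_F0[of n] by measurable
    from sets_F[OF this] show ?thesis by simp
  qed
  define k where "k j \<omega> = nat \<lfloor>real (Suc j) * \<tau> n \<omega>\<rfloor>" for j \<omega>
  define \<sigma> where "\<sigma> j \<omega> = (real (k j \<omega>) + 1) / real (Suc j)" for j \<omega>
  define D where "D j = {\<omega>\<in>space M. N (\<sigma> j \<omega> + s) \<omega> - N (\<sigma> j \<omega>) \<omega> = 0}" for j
  have \<sigma>: "\<tau> n \<omega> < \<sigma> j \<omega>" "\<sigma> j \<omega> \<le> \<tau> n \<omega> + inverse (real (Suc j))" if "\<omega> \<in> space M" for j \<omega>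
  proof -
    have "real (k j \<omega>) = of_int \<lfloor>real (Suc j) * \<tau> n \<omega>\<rfloor>"
      using \<tau>_nonneg[OF that, of n] by (simp add: k_def)
    then have "real (k j \<omega>) \<le> real (Suc j) * \<tau> n \<omega>" "real (Suc j) * \<tau> n \<omega> < real (k j \<omega>) + 1"
      by linarith+
    then have "real (k j \<omega>) / real (Suc j) \<le> \<tau> n \<omega>" "\<tau> n \<omega> < (real (k j \<omega>) + 1) / real (Suc j)"
      by (simp_all only: pos_divide_le_eq pos_less_divide_eq of_nat_0_less_iff zero_less_Suc mult.commute[of "\<tau> n \<omega>"])
    then show "\<tau> n \<omega> < \<sigma> j \<omega>" "\<sigma> j \<omega> \<le> \<tau> n \<omega> + inverse (real (Suc j))"
      by (simp_all only: \<sigma>_def add_divide_distrib inverse_eq_divide)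
  qed
  have prob_D: "E \<inter> D j \<in> events \<and> prob (E \<inter> D j) = prob E * exp (- s)" for j
  proof -
    define Ek where "Ek i = E \<inter> {\<omega>\<in>space M. k j \<omega> = i}" for i
    define t where "t i = (real i + 1) / real (Suc j)" for i
    define Z where "Z i = {\<omega>\<in>space M. N (t i + s) \<omega> - N (t i) \<omega> = 0}" for i
    have t0: "0 \<le> t i" for i by (simp add: t_def)
    have Ek: "Ek i \<in> sets (history n)" for i
    proof -
      have [measurable]: "\<tau> n \<in> borel_measurable (history n)" by (rule \<tau>_history) simp
      have "{\<omega>\<in>space (history n). k j \<omega> = i} \<in> sets (history n)" unfolding k_def by measurable
      then show ?thesis using E by (simp add: Ek_def sets.Int)
    qed
    then have Ek_ev: "Ek i \<in> events" for i using subalg_history by (auto simp: subalgebra_def)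
    have Z_ev: "Z i \<in> events" for i
    proof -
      have [measurable]: "random_variable (count_space UNIV) (N (t i))" "random_variable (count_space UNIV) (N (t i + s))"
        using poisson t0[of i] s by (auto simp: poisson_process_def)
      show ?thesis unfolding Z_def by measurable
    qed
    have prob_Ek: "prob (Ek i \<inter> Z i) = prob (Ek i) * exp (- s)" for i
    proof -
      have "\<tau> n \<omega> \<le> t i" if "\<omega> \<in> Ek i" for \<omega>
        using \<sigma>(1)[of \<omega> j] that by (simp add: Ek_def \<sigma>_def t_def)
      then have eq: "Ek i \<inter> {\<omega>\<in>space M. \<tau> n \<omega> \<le> t i} = Ek i"
        unfolding Ek_def by blast
      have "prob (Ek i \<inter> {\<omega>\<in>space M. \<tau> n \<omega> \<le> t i} \<inter> Z i) =
          prob (Ek i \<inter> {\<omega>\<in>space M. \<tau> n \<omega> \<le> t i}) * exp (- s)"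
        unfolding Z_def by (rule past_marks_indep_no_jump[OF t0 s history_before[OF t0 Ek]])
      then show ?thesis by (simp only: eq)
    qed
    have "(\<lambda>i. prob (Ek i)) sums prob (\<Union>i. Ek i)"
      by (rule finite_measure_UNION) (use Ek_ev in \<open>auto simp: disjoint_family_on_def Ek_def\<close>)
    moreover have UE: "(\<Union>i. Ek i) = E" using sets.sets_into_space[OF E_ev] by (auto simp: Ek_def)
    ultimately have "(\<lambda>i. prob (Ek i \<inter> Z i)) sums (prob E * exp (- s))"
      unfolding prob_Ek by (intro sums_mult2) simp
    moreover have "(\<lambda>i. prob (Ek i \<inter> Z i)) sums prob (\<Union>i. Ek i \<inter> Z i)"
      by (rule finite_measure_UNION) (use Ek_ev Z_ev in \<open>auto simp: disjoint_family_on_def Ek_def\<close>)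
    moreover have "(\<Union>i. Ek i \<inter> Z i) = E \<inter> D j"
      using sets.sets_into_space[OF E_ev] by (auto simp: Ek_def Z_def D_def \<sigma>_def t_def)
    moreover have "(\<Union>i. Ek i \<inter> Z i) \<in> events" using Ek_ev Z_ev by auto
    ultimately show ?thesis using sums_unique2 by metis
  qed
  have conv: "(\<lambda>j. indicator (E \<inter> D j) \<omega> :: real) \<longlonglongrightarrow> indicator (E \<inter> {\<omega>\<in>space M. s < gap n \<omega>}) \<omega>"
    if \<omega>: "\<omega> \<in> space M" for \<omega>
  proof (rule tendsto_eventually)
    have small: "eventually (\<lambda>j. inverse (real (Suc j)) < e) sequentially" if "0 < e" for e
      using order_tendstoD(2)[OF LIMSEQ_inverse_real_of_nat that] .
    have n0: "0 \<le> \<sigma> j \<omega>" for j by (simp add: \<sigma>_def)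
    have "eventually (\<lambda>j. \<omega> \<in> D j \<longleftrightarrow> s < gap n \<omega>) sequentially"
    proof (cases "s < gap n \<omega>")
      case True
      then have "0 < gap n \<omega> - s" by simp
      from small[OF this] show ?thesis
      proof eventually_elim
        case (elim j)
        have "N (\<sigma> j \<omega>) \<omega> = n" "N (\<sigma> j \<omega> + s) \<omega> = n"
          using \<sigma>[OF \<omega>, of j] elim True s n0[of j] by (auto simp: N_eq_iff[OF \<omega>] gap_def)
        then show ?case using True \<omega> by (simp add: D_def)
      qed
    next
      case False
      from small[OF gap_pos[OF \<omega>, of n]] show ?thesis
      proof eventually_elim
        case (elim j)
        have "N (\<sigma> j \<omega>) \<omega> = n"
          using \<sigma>[OF \<omega>, of j] elim n0[of j] by (auto simp: N_eq_iff[OF \<omega>] gap_def)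
        moreover have "Suc n \<le> N (\<sigma> j \<omega> + s) \<omega>"
          using \<sigma>(1)[OF \<omega>, of j] False s n0[of j] \<tau>_le_iff[OF \<omega>, of "\<sigma> j \<omega> + s" "Suc n"] by (auto simp: gap_def)
        ultimately show ?case using False by (simp add: D_def)
      qed
    qed
    then show "eventually (\<lambda>j. indicator (E \<inter> D j) \<omega> = (indicator (E \<inter> {\<omega>\<in>space M. s < gap n \<omega>}) \<omega> :: real)) sequentially"
      by eventually_elim (use \<omega> in \<open>auto simp: indicator_def\<close>)
  qed
  have D_ev: "E \<inter> D j \<in> events" for j using prob_D by blast
  have "(\<lambda>j. expectation (indicator (E \<inter> D j))) \<longlonglongrightarrow> (expectation (indicator (E \<inter> {\<omega>\<in>space M. s < gap n \<omega>})) :: real)"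
    by (rule integral_dominated_convergence[where w="\<lambda>_. 1"])
       (use D_ev E_ev gap_ev conv in \<open>auto intro!: borel_measurable_indicator split: split_indicator\<close>)
  then have "(\<lambda>j. prob E * exp (- s)) \<longlonglongrightarrow> prob (E \<inter> {\<omega>\<in>space M. s < gap n \<omega>})"
    using prob_D E_ev gap_ev by simp
  then show ?thesis by (rule LIMSEQ_unique[OF _ tendsto_const])
qed

lemma gap_measurable: "gap n \<in> borel_measurable M"
  using gap_measurable_F0 measurable_from_subalg[OF subalg] by blast

lemma prob_gap_greater:
  assumes a: "0 \<le> a"
  shows "prob {\<omega>\<in>space M. a < gap n \<omega>} = exp (- a)"
proof (cases "a = 0")
  case True
  then have "{\<omega>\<in>space M. a < gap n \<omega>} = space M" using gap_pos by auto
  then show ?thesis using True by (simp add: prob_space)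
next
  case False
  have "space M \<in> sets (history n)" using sets.top[of "history n"] by simp
  moreover have "space M \<inter> {\<omega>\<in>space M. a < gap n \<omega>} = {\<omega>\<in>space M. a < gap n \<omega>}" by auto
  ultimately show ?thesis using prob_gap_tail[of "space M" n a] a False by (simp add: prob_space)
qed

lemma gap_exponential: "distributed M lborel (gap n) (exponential_density 1)"
proof (rule exponential_distributedI)
  show gap[measurable]: "gap n \<in> borel_measurable M" by (rule gap_measurable)
  fix a :: real assume a: "0 \<le> a"
  have "{\<omega>\<in>space M. gap n \<omega> \<le> a} = space M - {\<omega>\<in>space M. a < gap n \<omega>}" by auto
  moreover have "{\<omega>\<in>space M. a < gap n \<omega>} \<in> events" by measurable
  ultimately have "prob {\<omega>\<in>space M. gap n \<omega> \<le> a} = 1 - exp (- a)"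
    by (simp add: prob_compl prob_gap_greater[OF a])
  then show "emeasure M {\<omega>\<in>space M. gap n \<omega> \<le> a} = 1 - ennreal (exp (- a * 1))"
    by (simp add: emeasure_eq_measure ennreal_minus flip: ennreal_1)
qed simp

end

text \<open>Independence in the form used for Fubini arguments. The values of \<open>X\<close> and \<open>Y\<close> may have different
  types: a waiting time is paired with the state of the walk, and the two of them with a sample point.\<close>

lemma (in prob_space) distr_pair_indep_subalgebras:
  assumes sub: "subalgebra M G" "subalgebra M H" and ind: "indep_set (sets G) (sets H)"
    and X: "X \<in> measurable G S" and Y: "Y \<in> measurable H T"
  shows "distr M S X \<Otimes>\<^sub>M distr M T Y = distr M (S \<Otimes>\<^sub>M T) (\<lambda>\<omega>. (X \<omega>, Y \<omega>))"
proof (rule pair_measure_eqI)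
  have sp: "space G = space M" "space H = space M" using sub by (simp_all add: subalgebra_def)
  have XM[measurable]: "X \<in> measurable M S" and YM[measurable]: "Y \<in> measurable M T"
    using measurable_from_subalg[OF sub(1) X] measurable_from_subalg[OF sub(2) Y] .
  show "sigma_finite_measure (distr M S X)" "sigma_finite_measure (distr M T Y)"
    using prob_space_distr[OF XM] prob_space_distr[OF YM]
    by (auto intro: prob_space_imp_sigma_finite)
  show "sets (distr M S X \<Otimes>\<^sub>M distr M T Y) = sets (distr M (S \<Otimes>\<^sub>M T) (\<lambda>\<omega>. (X \<omega>, Y \<omega>)))"
    by simp
  fix A B assume "A \<in> sets (distr M S X)" "B \<in> sets (distr M T Y)"
  then have A[measurable]: "A \<in> sets S" and B[measurable]: "B \<in> sets T" by simp_all
  have "X -` A \<inter> space M \<in> sets G" "Y -` B \<inter> space M \<in> sets H"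
    using measurable_sets[OF X A] measurable_sets[OF Y B] by (simp_all add: sp)
  then have "prob ((X -` A \<inter> space M) \<inter> (Y -` B \<inter> space M)) = prob (X -` A \<inter> space M) * prob (Y -` B \<inter> space M)"
    using ind by (simp add: indep_sets2_eq)
  moreover have "(X -` A \<inter> space M) \<inter> (Y -` B \<inter> space M) = (\<lambda>\<omega>. (X \<omega>, Y \<omega>)) -` (A \<times> B) \<inter> space M"
    by auto
  ultimately show "emeasure (distr M S X) A * emeasure (distr M T Y) B =
      emeasure (distr M (S \<Otimes>\<^sub>M T) (\<lambda>\<omega>. (X \<omega>, Y \<omega>))) (A \<times> B)"
    by (simp add: emeasure_distr emeasure_eq_measure ennreal_mult)
qed

context marked_clock
begin

lemma gap_indep_history:
  assumes X: "X \<in> measurable (history n) S"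
  shows "distr M S X \<Otimes>\<^sub>M distr M borel (gap n) = distr M (S \<Otimes>\<^sub>M borel) (\<lambda>\<omega>. (X \<omega>, gap n \<omega>))"
proof -
  let ?B = "{{\<omega>\<in>space M. s < gap n \<omega>} | s. True}"
  have gen: "?B \<subseteq> Pow (space M)" by auto
  define H where "H = sigma (space M) ?B"
  have H: "space H = space M" "sets H = sigma_sets (space M) ?B"
    unfolding H_def using space_measure_of[OF gen] sets_measure_of[OF gen] by auto
  have [measurable]: "gap n \<in> borel_measurable M"
    using gap_measurable_F0 measurable_from_subalg[OF subalg] by blast
  have B: "?B \<subseteq> events" by auto
  have "indep_set (sets (history n)) ?B"
    unfolding indep_sets2_eq
  proof (intro conjI ballI B)
    show his: "sets (history n) \<subseteq> events" using subalg_history by (simp add: subalgebra_def)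
    fix E b assume E: "E \<in> sets (history n)" and "b \<in> ?B"
    then obtain s where b: "b = {\<omega>\<in>space M. s < gap n \<omega>}" by auto
    show "prob (E \<inter> b) = prob E * prob b"
    proof (cases "0 < s")
      case True
      have "space M \<in> sets (history n)" using sets.top[of "history n"] by simp
      from prob_gap_tail[OF this True] have "prob b = exp (- s)"
        by (simp add: b prob_space Int_absorb1)
      then show ?thesis using prob_gap_tail[OF E True] b by simp
    next
      case False
      then have "b = space M" using gap_pos[of _ n] by (force simp: b)
      moreover have "E \<subseteq> space M" using his E sets.sets_into_space by blast
      ultimately show ?thesis by (simp add: prob_space Int_absorb2)
    qed
  qed
  moreover have "Int_stable ?B"
  proof (rule Int_stableI)
    fix a b assume "a \<in> ?B" "b \<in> ?B"
    then obtain s s' where "a = {\<omega>\<in>space M. s < gap n \<omega>}" "b = {\<omega>\<in>space M. s' < gap n \<omega>}" by auto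
    then show "a \<inter> b \<in> ?B" by (intro CollectI exI[of _ "max s s'"]) auto
  qed
  ultimately have "indep_set (sigma_sets (space M) (sets (history n))) (sigma_sets (space M) ?B)"
    by (intro indep_set_sigma_sets sets.Int_stable)
  then have "indep_set (sets (history n)) (sets H)"
    using sets.sigma_sets_eq[of "history n"] H by simp
  moreover have "subalgebra M H"
    using H sets.sigma_sets_subset[OF B] by (simp add: subalgebra_def)
  moreover have "gap n \<in> borel_measurable H"
    by (rule borel_measurableI_greater) (auto simp: H)
  ultimately show ?thesis using X by (intro distr_pair_indep_subalgebras[OF subalg_history])
qed

text \<open>The clock is included as a whole, so that the gap following \<open>\<tau> n\<close>, at the end of which the mark
  number \<open>n + 1\<close> is read, is measurable, while independence of that mark is preserved.\<close>

definition earlier :: "nat \<Rightarrow> 'w measure"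
  where "earlier n = sigma (space M) (\<Union>i\<in>{..n}. sets (F i))"

lemma earlier_gen: "(\<Union>i\<in>{..n}. sets (F i)) \<subseteq> Pow (space M)"
  by (rule UN_F_Pow)

lemma space_earlier [simp]: "space (earlier n) = space M"
  unfolding earlier_def by (rule space_measure_of[OF earlier_gen])

lemma sets_earlier: "sets (earlier n) = sigma_sets (space M) (\<Union>i\<in>{..n}. sets (F i))"
  unfolding earlier_def by (rule sets_measure_of[OF earlier_gen])

lemma subalg_earlier: "subalgebra M (earlier n)"
proof -
  have "(\<Union>i\<in>{..n}. sets (F i)) \<subseteq> events" using sets_F by blast
  from sets.sigma_sets_subset[OF this] show ?thesis by (simp add: subalgebra_def sets_earlier)
qed

lemma F0_le_earlier: "subalgebra (earlier n) (F 0)"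
  by (auto simp: subalgebra_def sets_earlier)

lemma history_le_earlier: "subalgebra (earlier n) (history n)"
  unfolding subalgebra_def
proof
  have "A \<in> sets (earlier n)" if "A \<in> (\<Union>i\<in>{1..n}. sets (F i))" for A
    using that unfolding sets_earlier by (intro sigma_sets.Basic) auto
  moreover have "A \<in> sets (earlier n)" if "A \<in> {{\<omega>\<in>space M. \<tau> i \<omega> \<le> a} | i a. i \<le> n}" for A
    using that \<tau>_F0 F0_le_earlier[of n] by (auto simp: subalgebra_def)
  ultimately have "sigma_sets (space (earlier n))
      ((\<Union>i\<in>{1..n}. sets (F i)) \<union> {{\<omega>\<in>space M. \<tau> i \<omega> \<le> a} | i a. i \<le> n}) \<subseteq> sets (earlier n)"
    by (intro sets.sigma_sets_subset) blast
  then show "sets (history n) \<subseteq> sets (earlier n)" by (simp add: sets_history)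
qed simp

lemma indep_earlier_next: "indep_set (sets (earlier n)) (sets (F (Suc n)))"
proof -
  have "indep_sets (\<lambda>b. sigma_sets (space M) (\<Union>i\<in>case_bool {..n} {Suc n} b. sets (F i))) UNIV"
  proof (rule indep_sets_collect_sigma)
    show "indep_sets (\<lambda>i. sets (F i)) (\<Union>b. case_bool {..n} {Suc n} b)"
      by (rule indep_sets_mono_index[OF subset_UNIV indep_F])
    show "Int_stable (sets (F i))" for i by (rule sets.Int_stable)
    show "disjoint_family (case_bool {..n} {Suc n})"
      by (simp add: disjoint_family_on_def split: bool.split)
  qed
  then have "indep_sets (case_bool (sets (earlier n)) (sigma_sets (space M) (sets (F (Suc n))))) UNIV"
    by (rule indep_sets_mono_sets) (auto simp: sets_earlier split: bool.split)
  moreover have "sigma_sets (space M) (sets (F (Suc n))) = sets (F (Suc n))"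
    using sets.sigma_sets_eq[of "F (Suc n)"] by simp
  ultimately show ?thesis by (simp add: indep_set_def)
qed

end

section \<open>The Volterra operator of the integral equation\<close>

text \<open>The data of the operator on the right-hand side of the integral equation. In the application \<open>m s\<close>
  is the mass of the measure \<open>S s\<close>, and \<open>- Y s\<close> is distributed according to its normalisation. Letting \<open>m\<close> vanish for
  \<open>s \<le> 0\<close> and \<open>V\<close> for negative times encodes the domain of integration \<open>0 < s \<le> r\<close> in the functions, so
  that all integrals range over the real line.\<close>

locale jump_kernel = prob_space M0 for M0 :: "'o measure" +
  fixes Y :: "real \<Rightarrow> 'o \<Rightarrow> real ^ 'd" and m :: "real \<Rightarrow> real" and V :: "real \<Rightarrow> real ^ 'd \<Rightarrow> real"
    and T Cm Cv :: real
  assumes T_pos: "0 < T"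
    and Y_meas: "(\<lambda>(s, \<omega>). Y s \<omega>) \<in> borel_measurable (borel \<Otimes>\<^sub>M M0)"
    and m_meas: "m \<in> borel_measurable borel"
    and V_meas: "(\<lambda>(r, z). V r z) \<in> borel_measurable (borel \<Otimes>\<^sub>M borel)"
    and m_out: "\<And>s. s \<le> 0 \<Longrightarrow> m s = 0" and m_bound: "\<And>s. \<bar>m s\<bar> \<le> Cm"
    and V_out: "\<And>r z. r < 0 \<Longrightarrow> V r z = 0" and V_bound: "\<And>r z. \<bar>V r z\<bar> \<le> Cv"
begin

definition avg :: "(real \<Rightarrow> real ^ 'd \<Rightarrow> real) \<Rightarrow> real \<Rightarrow> real ^ 'd \<Rightarrow> real \<Rightarrow> real"
  where "avg h r z s = (LINT \<omega>|M0. V (r - s) (z + Y s \<omega>) * h (r - s) (z + Y s \<omega>))"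

text \<open>If \<open>- Y s\<close> is distributed as \<open>S s / m s\<close>, this is
  \<open>\<integral> ds \<integral> S(s,dy) V(r-s,z-y) h(r-s,z-y)\<close> over \<open>0 < s \<le> r\<close>.\<close>

definition K :: "(real \<Rightarrow> real ^ 'd \<Rightarrow> real) \<Rightarrow> real \<Rightarrow> real ^ 'd \<Rightarrow> real"
  where "K h r z = (LINT s|lborel. m s * avg h r z s)"

text \<open>Boundedness is required up to time \<open>T\<close> only, since \<open>K\<close> evaluates its argument at earlier times.
  Negative times are included, for which the functions of interest vanish.\<close>

definition admissible :: "(real \<Rightarrow> real ^ 'd \<Rightarrow> real) \<Rightarrow> bool"
  where "admissible h \<longleftrightarrow> (\<lambda>(r, z). h r z) \<in> borel_measurable (borel \<Otimes>\<^sub>M borel) \<and>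
     (\<exists>B. \<forall>r\<le>T. \<forall>z. \<bar>h r z\<bar> \<le> B)"

lemma Cm_nonneg: "0 \<le> Cm" and Cv_nonneg: "0 \<le> Cv"
  using m_bound[of 0] V_bound[of 0 0] by auto

lemma admissibleI:
  "(\<lambda>(r, z). h r z) \<in> borel_measurable (borel \<Otimes>\<^sub>M borel) \<Longrightarrow> (\<And>r z. r \<le> T \<Longrightarrow> \<bar>h r z\<bar> \<le> B) \<Longrightarrow> admissible h"
  by (auto simp: admissible_def)

lemma admissible_measurable: "admissible h \<Longrightarrow> (\<lambda>(r, z). h r z) \<in> borel_measurable (borel \<Otimes>\<^sub>M borel)"
  by (simp add: admissible_def)

lemma avg_measurable:
  assumes "admissible h"
  shows "(\<lambda>p. avg h (fst (fst p)) (snd (fst p)) (snd p)) \<in> borel_measurable ((borel \<Otimes>\<^sub>M borel) \<Otimes>\<^sub>M borel)"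
proof -
  note [measurable] = V_meas Y_meas admissible_measurable[OF assms]
  show ?thesis unfolding avg_def by measurable
qed

lemma avg_measurable_time:
  assumes "admissible h"
  shows "(\<lambda>s. avg h r z s) \<in> borel_measurable borel"
proof -
  have "(\<lambda>s. ((r, z), s)) \<in> measurable borel ((borel \<Otimes>\<^sub>M borel) \<Otimes>\<^sub>M borel)" by measurable
  from measurable_compose[OF this avg_measurable[OF assms]] show ?thesis by simp
qed

lemma K_measurable:
  assumes "admissible h"
  shows "(\<lambda>(r, z). K h r z) \<in> borel_measurable (borel \<Otimes>\<^sub>M borel)"
proof -
  note [measurable] = avg_measurable[OF assms] m_meas
  show ?thesis unfolding K_def by measurable
qed

lemma avg_out: "r < s \<Longrightarrow> avg h r z s = 0"
  by (simp add: avg_def V_out)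

lemma integrand_integrable:
  assumes "admissible h" "r \<le> T" "0 \<le> s"
  shows "integrable M0 (\<lambda>\<omega>. V (r - s) (z + Y s \<omega>) * h (r - s) (z + Y s \<omega>))"
proof -
  note [measurable] = V_meas Y_meas admissible_measurable[OF assms(1)]
  obtain B where B: "\<And>r z. r \<le> T \<Longrightarrow> \<bar>h r z\<bar> \<le> B" using assms(1) by (auto simp: admissible_def)
  show ?thesis
  proof (rule integrable_const_bound[where B="Cv * B"])
    show "AE \<omega> in M0. norm (V (r - s) (z + Y s \<omega>) * h (r - s) (z + Y s \<omega>)) \<le> Cv * B"
      using assms(2,3) Cv_nonneg by (auto simp: abs_mult intro!: mult_mono V_bound B)
  qed measurable
qed

lemma avg_bound:
  assumes h: "admissible h" and s: "0 \<le> s" "r \<le> T" and b: "\<And>z. \<bar>h (r - s) z\<bar> \<le> b"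
  shows "\<bar>avg h r z s\<bar> \<le> Cv * b"
proof -
  have "\<bar>avg h r z s\<bar> \<le> (LINT \<omega>|M0. Cv * b)"
    unfolding avg_def real_norm_def[symmetric]
  proof (rule order_trans[OF integral_norm_bound integral_mono])
    show "integrable M0 (\<lambda>\<omega>. norm (V (r - s) (z + Y s \<omega>) * h (r - s) (z + Y s \<omega>)))"
      by (rule integrable_norm[OF integrand_integrable[OF h s(2,1)]])
    show "norm (V (r - s) (z + Y s \<omega>) * h (r - s) (z + Y s \<omega>)) \<le> Cv * b" for \<omega>
      using Cv_nonneg by (auto simp: abs_mult intro!: mult_mono V_bound b)
  qed simp
  then show ?thesis by (simp add: prob_space)
qed

lemma weighted_avg_integrable:
  assumes h: "admissible h" and r: "r \<le> T"
  shows "integrable lborel (\<lambda>s. m s * avg h r z s)"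
proof -
  obtain B where B: "\<And>r z. r \<le> T \<Longrightarrow> \<bar>h r z\<bar> \<le> B" using h by (auto simp: admissible_def)
  have B0: "0 \<le> B" using B[of 0 0] T_pos by auto
  note [measurable] = m_meas avg_measurable_time[OF h]
  show ?thesis
  proof (rule Bochner_Integration.integrable_bound[where f="\<lambda>s. indicator {0..r} s * (Cm * (Cv * B))"])
    show "integrable lborel (\<lambda>s. indicator {0..r} s * (Cm * (Cv * B)) :: real)"
      by (intro integrable_mult_left integrable_real_indicator) (auto simp: emeasure_lborel_Icc_eq)
    show "AE s in lborel. norm (m s * avg h r z s) \<le> norm (indicator {0..r} s * (Cm * (Cv * B)))"
    proof (rule AE_I2)
      fix s
      have "\<bar>m s\<bar> * \<bar>avg h r z s\<bar> \<le> Cm * (Cv * B)" if "0 \<le> s"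
        by (rule mult_mono) (use that r Cm_nonneg in \<open>auto intro!: m_bound avg_bound[OF h] B\<close>)
      then show "norm (m s * avg h r z s) \<le> norm (indicator {0..r} s * (Cm * (Cv * B)))"
        using Cm_nonneg Cv_nonneg B0
        by (cases "s \<le> 0"; cases "r < s") (auto simp: m_out avg_out abs_mult indicator_def)
    qed
  qed measurable
qed

text \<open>The Volterra estimate: one application of \<open>K\<close> integrates the bound \<open>q ^ n / n!\<close> over
  \<open>q = r - s\<close>.\<close>

lemma K_bound_power:
  assumes h: "admissible h" and b: "\<And>q z. 0 \<le> q \<Longrightarrow> q \<le> T \<Longrightarrow> \<bar>h q z\<bar> \<le> B * q ^ n / fact n"
    and r: "0 \<le> r" "r \<le> T"
  shows "\<bar>K h r z\<bar> \<le> (Cm * Cv) * B * r ^ Suc n / fact (Suc n)"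
proof -
  let ?g = "\<lambda>s. Cm * (Cv * (B * (r - s) ^ n / fact n))"
  define c where "c = Cm * (Cv * B) / fact (Suc n)"
  let ?G = "\<lambda>s. - (c * (r - s) ^ Suc n)"
  have FTC: "has_bochner_integral lborel (\<lambda>s. ?g s * indicator {0..r} s) (?G r - ?G 0)"
  proof (rule has_bochner_integral_FTC_Icc_real[OF r(1)])
    fix s :: real
    have "DERIV (\<lambda>s. (r - s) ^ Suc n) s :> - (real (Suc n) * (r - s) ^ n)"
      by (rule derivative_eq_intros refl | simp)+
    from DERIV_minus[OF DERIV_cmult[OF this, of c]]
    have "DERIV ?G s :> c * (real (Suc n) * (r - s) ^ n)" by simp
    moreover have "c * (real (Suc n) * (r - s) ^ n) = ?g s"
      by (simp add: c_def del: of_nat_Suc)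
    ultimately show "DERIV ?G s :> ?g s" by metis
  qed (auto intro!: continuous_intros)
  have "\<bar>K h r z\<bar> \<le> (LINT s|lborel. ?g s * indicator {0..r} s)"
    unfolding K_def real_norm_def[symmetric]
  proof (rule order_trans[OF integral_norm_bound integral_mono])
    show "integrable lborel (\<lambda>s. norm (m s * avg h r z s))"
      by (rule integrable_norm[OF weighted_avg_integrable[OF h r(2)]])
    show "integrable lborel (\<lambda>s. ?g s * indicator {0..r} s)"
      using FTC by (simp only: has_bochner_integral_iff)
    fix s
    have "\<bar>m s\<bar> * \<bar>avg h r z s\<bar> \<le> ?g s" if s: "0 \<le> s" "s \<le> r"
    proof (rule mult_mono[OF m_bound _ Cm_nonneg abs_ge_zero])
      show "\<bar>avg h r z s\<bar> \<le> Cv * (B * (r - s) ^ n / fact n)"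
        by (rule avg_bound[OF h s(1) r(2)], rule b) (use s r in auto)
    qed
    then show "norm (m s * avg h r z s) \<le> ?g s * indicator {0..r} s"
      by (cases "s \<le> 0"; cases "r < s") (auto simp: m_out avg_out abs_mult indicator_def)
  qed
  also have "\<dots> = (Cm * Cv) * B * r ^ Suc n / fact (Suc n)"
    using FTC[THEN has_bochner_integral_integral_eq] by (simp add: c_def mult_ac)
  finally show ?thesis .
qed

lemma K_zero: "r \<le> 0 \<Longrightarrow> K h r z = 0"
proof -
  assume "r \<le> 0"
  then have "m s * avg h r z s = 0" for s by (cases "s \<le> 0") (auto simp: m_out avg_out)
  then show ?thesis unfolding K_def by (simp only: integral_zero)
qed

lemma admissible_K:
  assumes h: "admissible h"
  shows "admissible (K h)"
proof -
  obtain B where B: "\<And>r z. r \<le> T \<Longrightarrow> \<bar>h r z\<bar> \<le> B" using h by (auto simp: admissible_def)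
  have B0: "0 \<le> B" using B[of 0 0] T_pos by auto
  show ?thesis
  proof (rule admissibleI[OF K_measurable[OF h]])
    fix r z assume r: "r \<le> T"
    show "\<bar>K h r z\<bar> \<le> (Cm * Cv) * B * T"
    proof (cases "0 \<le> r")
      case True
      have "\<bar>K h r z\<bar> \<le> (Cm * Cv) * B * r ^ Suc 0 / fact (Suc 0)"
        by (rule K_bound_power[OF h _ True r]) (simp add: B)
      also have "\<dots> \<le> (Cm * Cv) * B * T" using r B0 Cm_nonneg Cv_nonneg by (simp add: mult_left_mono)
      finally show ?thesis .
    next
      case False
      then show ?thesis using K_zero[of r h z] B0 Cm_nonneg Cv_nonneg T_pos by simp
    qed
  qed
qed

lemma admissible_iterate: "admissible w \<Longrightarrow> admissible ((K ^^ n) w)"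
  by (induction n) (auto intro: admissible_K)

lemma iterate_bound:
  assumes w: "admissible w" "\<And>q z. 0 \<le> q \<Longrightarrow> q \<le> T \<Longrightarrow> \<bar>w q z\<bar> \<le> B" and r: "0 \<le> r" "r \<le> T"
  shows "\<bar>(K ^^ n) w r z\<bar> \<le> B * (Cm * Cv) ^ n * r ^ n / fact n"
  using r
proof (induction n arbitrary: r z)
  case (Suc n)
  have "\<bar>K ((K ^^ n) w) r z\<bar> \<le> (Cm * Cv) * (B * (Cm * Cv) ^ n) * r ^ Suc n / fact (Suc n)"
    by (rule K_bound_power[OF admissible_iterate[OF w(1)] Suc.IH Suc.prems])
  then show ?case by (simp add: mult_ac)
qed (simp add: w)

lemma K_cong:
  assumes "\<And>q z. 0 \<le> q \<Longrightarrow> q \<le> T \<Longrightarrow> h q z = h' q z" "r \<le> T"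
  shows "K h r z = K h' r z"
  unfolding K_def
proof (rule Bochner_Integration.integral_cong)
  fix s
  have "V (r - s) y * h (r - s) y = V (r - s) y * h' (r - s) y" if "0 < s" for y
    using assms that by (cases "r < s") (auto simp: V_out)
  then have "avg h r z s = avg h' r z s" if "0 < s" using that unfolding avg_def by (simp only:)
  then show "m s * avg h r z s = m s * avg h' r z s"
    by (cases "s \<le> 0") (auto simp: m_out)
qed simp

lemma admissible_add: assumes "admissible f" "admissible g" shows "admissible (\<lambda>r z. f r z + g r z)"
proof -
  note [measurable] = admissible_measurable[OF assms(1)] admissible_measurable[OF assms(2)]
  obtain A B where "\<And>r z. r \<le> T \<Longrightarrow> \<bar>f r z\<bar> \<le> A" "\<And>r z. r \<le> T \<Longrightarrow> \<bar>g r z\<bar> \<le> B"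
    using assms unfolding admissible_def by blast
  then show ?thesis
    by (intro admissibleI[where B="A + B"]) (measurable, meson abs_triangle_ineq add_mono order_trans)
qed

lemma admissible_uminus: assumes "admissible f" shows "admissible (\<lambda>r z. - f r z)"
proof -
  note [measurable] = admissible_measurable[OF assms(1)]
  show ?thesis using assms by (auto simp: admissible_def)
qed

lemma admissible_diff: assumes "admissible f" "admissible g" shows "admissible (\<lambda>r z. f r z - g r z)"
  using admissible_add[OF assms(1) admissible_uminus[OF assms(2)]] by simp

lemma K_diff:
  assumes "admissible f" "admissible g" "r \<le> T"
  shows "K (\<lambda>r z. f r z - g r z) r z = K f r z - K g r z"
proof -
  have "m s * avg (\<lambda>r z. f r z - g r z) r z s = m s * avg f r z s - m s * avg g r z s" for s
  proof (cases "s \<le> 0")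
    case False
    then have "avg (\<lambda>r z. f r z - g r z) r z s = avg f r z s - avg g r z s"
      using integrand_integrable[OF assms(1,3), of s z] integrand_integrable[OF assms(2,3), of s z]
      unfolding avg_def right_diff_distrib by simp
    then show ?thesis by (simp add: right_diff_distrib)
  qed (simp add: m_out)
  then show ?thesis
    unfolding K_def using weighted_avg_integrable assms by simp
qed

lemma K_add:
  assumes "admissible f" "admissible g" "r \<le> T"
  shows "K (\<lambda>r z. f r z + g r z) r z = K f r z + K g r z"
  using K_diff[OF admissible_add[OF assms(1,2)] assms(2,3), of z] by simp

lemma admissible_zero: "admissible (\<lambda>_ _. 0)"
  by (rule admissibleI[where B=0]) auto

lemma admissible_partial_sum: "admissible w \<Longrightarrow> admissible (\<lambda>r z. \<Sum>i<n. (K ^^ i) w r z)"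
  by (induction n) (auto intro: admissible_zero admissible_add admissible_iterate)

lemma K_partial_sum:
  assumes "admissible w" "r \<le> T"
  shows "K (\<lambda>r z. \<Sum>i<n. (K ^^ i) w r z) r z = (\<Sum>i<n. (K ^^ Suc i) w r z)"
proof (induction n)
  case 0
  show ?case by (simp add: K_def avg_def)
next
  case (Suc n)
  then show ?case
    by (simp add: K_add[OF admissible_partial_sum[OF assms(1)] admissible_iterate[OF assms(1)] assms(2)])
qed

text \<open>Such a \<open>d\<close> equals all its iterates under \<open>K\<close>, and these tend to zero by the factorial bound.\<close>

lemma homogeneous_unique:
  assumes d: "admissible d" and eq: "\<And>r z. 0 \<le> r \<Longrightarrow> r \<le> T \<Longrightarrow> d r z = K d r z" and r: "0 \<le> r" "r \<le> T"
  shows "d r z = 0"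
proof -
  obtain B where B: "\<And>r z. r \<le> T \<Longrightarrow> \<bar>d r z\<bar> \<le> B" using d by (auto simp: admissible_def)
  have it: "(K ^^ n) d q z = d q z" if "0 \<le> q" "q \<le> T" for n q z
    using that
  proof (induction n arbitrary: q z)
    case (Suc n)
    have "K ((K ^^ n) d) q z = K d q z" by (rule K_cong[OF Suc.IH Suc.prems(2)])
    then show ?case using eq Suc.prems by simp
  qed simp
  have "\<bar>d r z\<bar> \<le> B * ((Cm * Cv * r) ^ n / fact n)" for n
    using iterate_bound[OF d B r, of n z] it[OF r, of n z] by (simp add: power_mult_distrib mult_ac)
  moreover have "(\<lambda>n. B * ((Cm * Cv * r) ^ n / fact n)) \<longlonglongrightarrow> B * 0"
    using summable_LIMSEQ_zero[OF summable_exp[of "Cm * Cv * r"]]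
    by (intro tendsto_mult_left) (simp add: field_simps)
  ultimately have "\<bar>d r z\<bar> \<le> B * 0" by (intro LIMSEQ_le_const[of _ _ "\<bar>d r z\<bar>"]) auto
  then show ?thesis by simp
qed

text \<open>The Neumann series of \<open>h = w + K h\<close>. Outside \<open>[0, T]\<close> the factorial bound says nothing about the
  series, and the value is set to zero.\<close>

definition solution :: "(real \<Rightarrow> real ^ 'd \<Rightarrow> real) \<Rightarrow> real \<Rightarrow> real ^ 'd \<Rightarrow> real"
  where "solution w r z = (if r < 0 \<or> T < r then 0 else (\<Sum>n. (K ^^ n) w r z))"

context
  fixes w B
  assumes w: "admissible w" and B: "\<And>q z. 0 \<le> q \<Longrightarrow> q \<le> T \<Longrightarrow> \<bar>w q z\<bar> \<le> B"
begin

lemma iterate_bound_T: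
  assumes "0 \<le> r" "r \<le> T"
  shows "\<bar>(K ^^ n) w r z\<bar> \<le> B * ((Cm * Cv * T) ^ n / fact n)"
proof -
  have B0: "0 \<le> B" using B[of 0 0] T_pos by auto
  have "\<bar>(K ^^ n) w r z\<bar> \<le> B * ((Cm * Cv) ^ n * r ^ n / fact n)"
    using iterate_bound[OF w B assms, of n z] by simp
  also have "\<dots> \<le> B * ((Cm * Cv) ^ n * T ^ n / fact n)"
    using assms B0 Cm_nonneg Cv_nonneg
    by (intro mult_left_mono divide_right_mono power_mono) auto
  finally show ?thesis by (simp add: power_mult_distrib)
qed

lemma summable_bound: "summable (\<lambda>n. B * ((Cm * Cv * T) ^ n / fact n))"
  using summable_exp[of "Cm * Cv * T"] by (intro summable_mult) (simp add: field_simps)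

lemma summable_iterates:
  "0 \<le> r \<Longrightarrow> r \<le> T \<Longrightarrow> summable (\<lambda>n. (K ^^ n) w r z)"
  by (rule summable_comparison_test'[OF summable_bound]) (simp only: real_norm_def iterate_bound_T)

text \<open>Uniform convergence of the Neumann series. The truncation outside \<open>[0, T]\<close> is repeated for the
  partial sum so that the case \<open>n = 0\<close> is a bound of the solution at all times up to \<open>T\<close>.\<close>

lemma solution_tail:
  assumes r: "r \<le> T"
  shows "\<bar>solution w r z - (if r < 0 \<or> T < r then 0 else \<Sum>i<n. (K ^^ i) w r z)\<bar>
     \<le> (\<Sum>i. B * ((Cm * Cv * T) ^ (i + n) / fact (i + n)))"
proof (cases "0 \<le> r")
  case True
  have sb: "summable (\<lambda>i. B * ((Cm * Cv * T) ^ (i + n) / fact (i + n)))"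
    using summable_ignore_initial_segment[OF summable_bound, of n] .
  have "solution w r z - (\<Sum>i<n. (K ^^ i) w r z) = (\<Sum>i. (K ^^ (i + n)) w r z)"
    using suminf_minus_initial_segment[OF summable_iterates[OF True r], of n z] True r by (simp add: solution_def)
  moreover have "norm (\<Sum>i. (K ^^ (i + n)) w r z) \<le> (\<Sum>i. B * ((Cm * Cv * T) ^ (i + n) / fact (i + n)))"
    by (rule norm_suminf_le[OF _ sb]) (use iterate_bound_T[OF True r] in \<open>simp only: real_norm_def\<close>)
  ultimately show ?thesis using True r by simp
next
  case False
  have "0 \<le> B" using B[of 0 0] T_pos by auto
  then have "0 \<le> (\<Sum>i. B * ((Cm * Cv * T) ^ (i + n) / fact (i + n)))"
    using summable_ignore_initial_segment[OF summable_bound, of n] Cm_nonneg Cv_nonneg T_pos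
    by (intro suminf_nonneg) auto
  then show ?thesis using False by (simp add: solution_def)
qed

lemma admissible_solution: "admissible (solution w)"
proof (rule admissibleI)
  note [measurable] = admissible_measurable[OF admissible_iterate[OF w]]
  show "(\<lambda>(r, z). solution w r z) \<in> borel_measurable (borel \<Otimes>\<^sub>M borel)"
    unfolding solution_def by measurable
  show "\<bar>solution w r z\<bar> \<le> (\<Sum>i. B * ((Cm * Cv * T) ^ i / fact i))" if "r \<le> T" for r z
    using solution_tail[OF that, of z 0] by (simp split: if_splits)
qed

text \<open>Applying \<open>K\<close> to the partial sums shifts the series by one term. Passing to the limit under \<open>K\<close> is
  justified by the uniform smallness of the tails.\<close>

lemma solution_fixed_point:
  assumes r: "0 \<le> r" "r \<le> T"
  shows "solution w r z = w r z + K (solution w) r z"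
proof -
  let ?P = "\<lambda>n r z. \<Sum>i<n. (K ^^ i) w r z"
  let ?e = "\<lambda>n. (\<Sum>i. B * ((Cm * Cv * T) ^ (i + n) / fact (i + n)))"
  have gd: "admissible (\<lambda>r z. solution w r z - ?P n r z)" for n
    by (intro admissible_diff admissible_solution admissible_partial_sum w)
  have "\<bar>K (solution w) r z - (\<Sum>i<n. (K ^^ Suc i) w r z)\<bar> \<le> Cm * Cv * r * ?e n" for n
  proof -
    have "\<bar>K (\<lambda>r z. solution w r z - ?P n r z) r z\<bar> \<le> (Cm * Cv) * ?e n * r ^ Suc 0 / fact (Suc 0)"
    proof (rule K_bound_power[OF gd _ r])
      fix q z assume "0 \<le> q" "q \<le> T"
      then show "\<bar>solution w q z - ?P n q z\<bar> \<le> ?e n * q ^ 0 / fact 0"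
        using solution_tail[of q z n] by simp
    qed
    then show ?thesis
      using K_diff[OF admissible_solution admissible_partial_sum[OF w] r(2), of n z] K_partial_sum[OF w r(2), of n z]
      by (simp add: mult_ac)
  qed
  then have bd: "\<forall>\<^sub>F n in sequentially. norm (K (solution w) r z - (\<Sum>i<n. (K ^^ Suc i) w r z)) \<le> Cm * Cv * r * ?e n"
    by (simp only: real_norm_def eventually_True)
  have "(\<lambda>n. Cm * Cv * r * ?e n) \<longlonglongrightarrow> Cm * Cv * r * 0"
    by (intro tendsto_mult_left suminf_exist_split2 summable_bound)
  then have "(\<lambda>n. Cm * Cv * r * ?e n) \<longlonglongrightarrow> 0" by (simp only: mult_zero_right)
  from Lim_null_comparison[OF bd this]
  have "(\<lambda>n. K (solution w) r z - (\<Sum>i<n. (K ^^ Suc i) w r z)) \<longlonglongrightarrow> 0" .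
  from tendsto_diff[OF tendsto_const[of "K (solution w) r z"] this]
  have tail: "(\<lambda>i. (K ^^ Suc i) w r z) sums K (solution w) r z" by (simp add: sums_def)
  have "(\<lambda>i. (K ^^ i) w r z) sums solution w r z"
    using summable_iterates[OF r] r by (simp add: solution_def summable_sums)
  then have "(\<lambda>i. (K ^^ Suc i) w r z) sums (solution w r z - w r z)"
    using sums_Suc_iff[of "\<lambda>i. (K ^^ i) w r z" "solution w r z - w r z"] by simp
  from sums_unique2[OF this tail] show ?thesis by simp
qed

lemma solution_unique:
  assumes v: "admissible v" and eq: "\<And>r z. 0 \<le> r \<Longrightarrow> r \<le> T \<Longrightarrow> v r z = w r z + K v r z"
    and r: "0 \<le> r" "r \<le> T"
  shows "v r z = solution w r z"
proof -
  have "v r z - solution w r z = 0"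
  proof (rule homogeneous_unique[OF admissible_diff[OF v admissible_solution] _ r])
    fix q z assume q: "0 \<le> q" "q \<le> T"
    show "v q z - solution w q z = K (\<lambda>r z. v r z - solution w r z) q z"
      using eq[OF q] solution_fixed_point[OF q, of z] K_diff[OF v admissible_solution q(2), of z] by simp
  qed
  then show ?thesis by simp
qed

end

end

section \<open>The walk at the jump times\<close>

text \<open>The walk observed at its jump times, for a fixed horizon \<open>t\<close>. The process \<open>Xc i\<close> is jointly measurable
  with respect to its own sigma-algebra \<open>F i\<close>; this is what permits its evaluation at the independent
  random time \<open>gap (i - 1)\<close>.\<close>

locale marked_walk = marked_clock M F N \<tau> + kern: jump_kernel M0 Y m V T Cm Cv
  for M :: "'w measure" and F N \<tau>
    and M0 :: "'o measure" and Y :: "real \<Rightarrow> 'o \<Rightarrow> real ^ 'd" and m V T Cm Cv +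
  fixes Xc :: "nat \<Rightarrow> real \<Rightarrow> 'w \<Rightarrow> real ^ 'd" and t :: real
  assumes Xc_meas: "\<And>i. 1 \<le> i \<Longrightarrow> (\<lambda>(s, \<omega>). Xc i s \<omega>) \<in> borel_measurable (borel \<Otimes>\<^sub>M F i)"
    and Xc_law: "\<And>i s. 1 \<le> i \<Longrightarrow> distr M borel (Xc i s) = distr M0 borel (Y s)"
    and t: "0 \<le> t" "t \<le> T"
begin

text \<open>The start is a random variable \<open>\<xi>\<close>, which in the application is almost surely constant. The independence
  arguments are carried out for the walk with a constant start, as this one is measurable with respect
  to \<open>history n\<close>.\<close>

primrec place :: "('w \<Rightarrow> real ^ 'd) \<Rightarrow> nat \<Rightarrow> 'w \<Rightarrow> real ^ 'd" where
  "place \<xi> 0 \<omega> = \<xi> \<omega>"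
| "place \<xi> (Suc n) \<omega> = place \<xi> n \<omega> + Xc (Suc n) (gap n \<omega>) \<omega>"

primrec weight :: "('w \<Rightarrow> real ^ 'd) \<Rightarrow> nat \<Rightarrow> 'w \<Rightarrow> real" where
  "weight \<xi> 0 \<omega> = 1"
| "weight \<xi> (Suc n) \<omega> = weight \<xi> n \<omega> * (m (gap n \<omega>) * V (t - \<tau> (Suc n) \<omega>) (place \<xi> (Suc n) \<omega>))"

lemma start_cong:
  assumes "\<xi> \<omega> = \<xi>' \<omega>"
  shows "place \<xi> n \<omega> = place \<xi>' n \<omega> \<and> weight \<xi> n \<omega> = weight \<xi>' n \<omega>"
  by (induction n) (simp_all add: assms)

lemma weight_eq_prod:
  "weight \<xi> n \<omega> = (\<Prod>i=1..n. m (\<tau> i \<omega> - \<tau> (i - 1) \<omega>) * V (t - \<tau> i \<omega>) (place \<xi> i \<omega>))"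
proof (induction n)
  case (Suc n)
  then show ?case by (simp add: prod.cl_ivl_Suc gap_def)
qed simp

lemma subalg_ident: "subalgebra G H \<Longrightarrow> (\<lambda>\<omega>. \<omega>) \<in> measurable G H"
  by (auto simp: subalgebra_def intro!: measurableI)

lemma displacement_measurable:
  assumes "subalgebra G (F (Suc n))" "\<sigma> \<in> borel_measurable G"
  shows "(\<lambda>\<omega>. Xc (Suc n) (\<sigma> \<omega>) \<omega>) \<in> borel_measurable G"
proof -
  have "(\<lambda>\<omega>. (\<sigma> \<omega>, \<omega>)) \<in> measurable G (borel \<Otimes>\<^sub>M F (Suc n))"
    using assms(2) subalg_ident[OF assms(1)] by (rule measurable_Pair)
  from measurable_compose[OF this Xc_meas[of "Suc n"]] show ?thesis by simp
qed

lemma place_weight_measurable: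
  assumes \<xi>: "\<xi> \<in> borel_measurable G"
    and \<tau>: "\<And>i. i \<le> n \<Longrightarrow> \<tau> i \<in> borel_measurable G"
    and sub: "\<And>i. 1 \<le> i \<Longrightarrow> i \<le> n \<Longrightarrow> subalgebra G (F i)"
  shows "place \<xi> n \<in> borel_measurable G \<and> weight \<xi> n \<in> borel_measurable G"
  using \<tau> sub
proof (induction n)
  case 0
  have "place \<xi> 0 = \<xi>" "weight \<xi> 0 = (\<lambda>_. 1)" by auto
  then show ?case using \<xi> by simp
next
  case (Suc n)
  have [measurable]: "\<tau> n \<in> borel_measurable G" "\<tau> (Suc n) \<in> borel_measurable G" using Suc.prems by auto
  have IH: "place \<xi> n \<in> borel_measurable G" "weight \<xi> n \<in> borel_measurable G" using Suc by auto
  note [measurable] = IH kern.V_meas kern.m_meas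
  have g[measurable]: "gap n \<in> borel_measurable G" unfolding gap_def by measurable
  have [measurable]: "(\<lambda>\<omega>. Xc (Suc n) (gap n \<omega>) \<omega>) \<in> borel_measurable G"
    using Suc.prems(2) by (intro displacement_measurable g) auto
  have "place \<xi> (Suc n) = (\<lambda>\<omega>. place \<xi> n \<omega> + Xc (Suc n) (gap n \<omega>) \<omega>)" by auto
  then have p[measurable]: "place \<xi> (Suc n) \<in> borel_measurable G" by simp
  have "weight \<xi> (Suc n) = (\<lambda>\<omega>. weight \<xi> n \<omega> * (m (gap n \<omega>) * V (t - \<tau> (Suc n) \<omega>) (place \<xi> (Suc n) \<omega>)))" by auto
  moreover have "(\<lambda>\<omega>. weight \<xi> n \<omega> * (m (gap n \<omega>) * V (t - \<tau> (Suc n) \<omega>) (place \<xi> (Suc n) \<omega>))) \<in> borel_measurable G"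
    by measurable
  ultimately show ?case using p by simp
qed

lemma \<tau>_measurable: "\<tau> n \<in> borel_measurable M"
  by (rule measurable_from_subalg[OF subalg \<tau>_measurable_F0])

lemma place_measurable: "\<xi> \<in> borel_measurable M \<Longrightarrow> place \<xi> n \<in> borel_measurable M"
  and weight_measurable: "\<xi> \<in> borel_measurable M \<Longrightarrow> weight \<xi> n \<in> borel_measurable M"
  using place_weight_measurable[of \<xi> M n] \<tau>_measurable subalg by auto

lemma place_history: "place (\<lambda>_. x) n \<in> borel_measurable (history n)"
  and weight_history: "weight (\<lambda>_. x) n \<in> borel_measurable (history n)"
  using place_weight_measurable[of "\<lambda>_. x" "history n" n] \<tau>_history F_le_history by auto

lemma weight_bound: "\<bar>weight \<xi> n \<omega>\<bar> \<le> (Cm * Cv) ^ n"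
proof (induction n)
  case (Suc n)
  have "\<bar>weight \<xi> (Suc n) \<omega>\<bar> = \<bar>weight \<xi> n \<omega>\<bar> * (\<bar>m (gap n \<omega>)\<bar> * \<bar>V (t - \<tau> (Suc n) \<omega>) (place \<xi> (Suc n) \<omega>)\<bar>)"
    by (simp add: abs_mult)
  also have "\<dots> \<le> (Cm * Cv) ^ n * (Cm * Cv)"
    using kern.Cm_nonneg kern.Cv_nonneg
    by (intro mult_mono Suc kern.m_bound kern.V_bound) auto
  finally show ?case by (simp add: mult_ac)
qed simp

text \<open>Conditioning on the past \<open>A\<close> of the walk: the next waiting time \<open>s\<close> has density
  \<open>exponential_density 1\<close> and, given that it equals \<open>s\<close>, the next displacement has the law of \<open>Y s\<close>. First
  the mark number \<open>n + 1\<close> is integrated out, for fixed values of \<open>A\<close> and the waiting time, by its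
  independence of \<open>earlier n\<close>; then the waiting time, by its independence of \<open>history n\<close>.\<close>

lemma next_step_integral:
  fixes f :: "('a \<times> real) \<times> (real ^ 'd) \<Rightarrow> real"
  assumes A: "A \<in> measurable (history n) S"
    and f: "f \<in> borel_measurable ((S \<Otimes>\<^sub>M borel) \<Otimes>\<^sub>M borel)"
    and int: "integrable M (\<lambda>\<omega>. f ((A \<omega>, gap n \<omega>), Xc (Suc n) (gap n \<omega>) \<omega>))"
  shows "(LINT \<omega>|M. f ((A \<omega>, gap n \<omega>), Xc (Suc n) (gap n \<omega>) \<omega>)) =
    (LINT \<omega>|M. (LINT s|lborel. exponential_density 1 s * (LINT \<omega>'|M0. f ((A \<omega>, s), Y s \<omega>'))))"
proof -
  let ?F = "F (Suc n)"
  let ?AG = "\<lambda>\<omega>. (A \<omega>, gap n \<omega>)"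
  have AM[measurable]: "A \<in> measurable M S" by (rule measurable_from_subalg[OF subalg_history A])
  have gM[measurable]: "gap n \<in> borel_measurable M" by (rule gap_measurable)
  have AGM[measurable]: "?AG \<in> measurable M (S \<Otimes>\<^sub>M borel)" by measurable
  have idM: "(\<lambda>\<omega>. \<omega>) \<in> measurable M ?F" by (rule subalg_ident[OF subalg])
  define P1 where "P1 = distr M (S \<Otimes>\<^sub>M borel) ?AG"
  \<comment> \<open>The random element with law \<open>P2\<close> is the sample point itself, regarded as an element of the coarser space \<open>F (Suc n)\<close>: the whole path of \<open>Xc (Suc n)\<close> has to be kept.\<close>
  define P2 where "P2 = distr M ?F (\<lambda>\<omega>. \<omega>)"
  define J where "J p = (LINT \<omega>'|M0. f (p, Y (snd p) \<omega>'))" for p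
  interpret P1: prob_space P1 unfolding P1_def by (rule prob_space_distr[OF AGM])
  interpret P2: prob_space P2 unfolding P2_def by (rule prob_space_distr[OF idM])
  interpret P12: pair_prob_space P1 P2 ..
  have sP1: "space P1 = space S \<times> UNIV" by (simp add: P1_def space_pair_measure)

  have prod1: "P1 \<Otimes>\<^sub>M P2 = distr M ((S \<Otimes>\<^sub>M borel) \<Otimes>\<^sub>M ?F) (\<lambda>\<omega>. (?AG \<omega>, \<omega>))"
    unfolding P1_def P2_def
  proof (rule distr_pair_indep_subalgebras[OF subalg_earlier subalg indep_earlier_next])
    show "?AG \<in> measurable (earlier n) (S \<Otimes>\<^sub>M borel)"
      using measurable_from_subalg[OF history_le_earlier A]
        measurable_from_subalg[OF F0_le_earlier gap_measurable_F0] by (rule measurable_Pair)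
  qed simp
  have XcF: "(\<lambda>(s, \<omega>). Xc (Suc n) s \<omega>) \<in> borel_measurable (borel \<Otimes>\<^sub>M ?F)" by (rule Xc_meas) simp
  note [measurable] = f XcF kern.Y_meas
  have gm: "(\<lambda>(p, \<omega>). f (p, Xc (Suc n) (snd p) \<omega>)) \<in> borel_measurable ((S \<Otimes>\<^sub>M borel) \<Otimes>\<^sub>M ?F)"
    by measurable
  have pair: "(\<lambda>\<omega>. (?AG \<omega>, \<omega>)) \<in> measurable M ((S \<Otimes>\<^sub>M borel) \<Otimes>\<^sub>M ?F)"
    by (rule measurable_Pair[OF AGM idM])
  have int': "integrable (P1 \<Otimes>\<^sub>M P2) (\<lambda>(p, \<omega>). f (p, Xc (Suc n) (snd p) \<omega>))"
    unfolding prod1 using int by (subst integrable_distr_eq[OF pair gm]) simp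
  have "(LINT \<omega>|M. f (?AG \<omega>, Xc (Suc n) (gap n \<omega>) \<omega>)) =
      integral\<^sup>L (P1 \<Otimes>\<^sub>M P2) (\<lambda>(p, \<omega>). f (p, Xc (Suc n) (snd p) \<omega>))"
    unfolding prod1 by (subst integral_distr[OF pair gm]) simp
  also have "\<dots> = (LINT p|P1. LINT \<omega>|P2. f (p, Xc (Suc n) (snd p) \<omega>))"
    using P12.integral_fst'[OF int'] by simp
  also have inner: "(LINT \<omega>|P2. f (p, Xc (Suc n) (snd p) \<omega>)) = J p" if p: "p \<in> space P1" for p
  proof -
    have fp: "(\<lambda>y. f (p, y)) \<in> borel_measurable borel"
      using p measurable_Pair2[OF f, of p] by (simp add: P1_def)
    have XcFs: "Xc (Suc n) (snd p) \<in> borel_measurable ?F"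
      using measurable_Pair2[OF XcF, of "snd p"] by simp
    then have XcMs: "Xc (Suc n) (snd p) \<in> borel_measurable M" by (rule measurable_from_subalg[OF subalg])
    have Ys: "Y (snd p) \<in> borel_measurable M0"
      using measurable_Pair2[OF kern.Y_meas, of "snd p"] by simp
    have "(LINT \<omega>|P2. f (p, Xc (Suc n) (snd p) \<omega>)) = (LINT \<omega>|M. f (p, Xc (Suc n) (snd p) \<omega>))"
      unfolding P2_def by (rule integral_distr[OF idM measurable_compose[OF XcFs fp]])
    also have "\<dots> = (LINT y|distr M borel (Xc (Suc n) (snd p)). f (p, y))"
      by (rule integral_distr[OF XcMs fp, symmetric])
    also have "\<dots> = (LINT y|distr M0 borel (Y (snd p)). f (p, y))"
      using Xc_law[of "Suc n" "snd p"] by simp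
    also have "\<dots> = J p" unfolding J_def by (rule integral_distr[OF Ys fp])
    finally show ?thesis .
  qed
  then have "(LINT p|P1. LINT \<omega>|P2. f (p, Xc (Suc n) (snd p) \<omega>)) = (LINT p|P1. J p)"
    by (intro Bochner_Integration.integral_cong) auto
  also have "(LINT p|P1. J p) = (LINT \<omega>|M. LINT s|lborel. exponential_density 1 s * J (A \<omega>, s))"
  proof -
    define D1 where "D1 = distr M S A"
    define D2 where "D2 = distr M borel (gap n)"
    interpret D1: prob_space D1 unfolding D1_def by (rule prob_space_distr[OF AM])
    interpret D2: prob_space D2 unfolding D2_def by (rule prob_space_distr[OF gM])
    interpret D12: pair_prob_space D1 D2 ..
    have prod2: "P1 = D1 \<Otimes>\<^sub>M D2"
      unfolding P1_def D1_def D2_def by (rule gap_indep_history[OF A, symmetric])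
    have Jm[measurable]: "J \<in> borel_measurable (S \<Otimes>\<^sub>M borel)" unfolding J_def by measurable
    have "integrable P1 (\<lambda>p. LINT \<omega>|P2. f (p, Xc (Suc n) (snd p) \<omega>))"
      using P12.integrable_fst'[OF int'] by simp
    then have Ji: "integrable (D1 \<Otimes>\<^sub>M D2) J"
      unfolding prod2[symmetric] using inner by (subst (asm) Bochner_Integration.integrable_cong[OF refl]) auto
    have D2m: "sets D2 = sets borel" by (simp add: D2_def)
    have Jm2: "(\<lambda>a. LINT s|D2. J (a, s)) \<in> borel_measurable S"
    proof -
      have "(\<lambda>(a, s). J (a, s)) \<in> borel_measurable (S \<Otimes>\<^sub>M D2)"
        using Jm unfolding measurable_cong_sets[OF sets_pair_measure_cong[OF refl D2m] refl] by simp
      from D2.borel_measurable_lebesgue_integral[OF this] show ?thesis .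
    qed
    have "(LINT p|P1. J p) = (LINT a|D1. LINT s|D2. J (a, s))"
      unfolding prod2 by (rule D12.integral_fst'[OF Ji, symmetric])
    also have "\<dots> = (LINT \<omega>|M. LINT s|D2. J (A \<omega>, s))"
      unfolding D1_def by (rule integral_distr[OF AM Jm2])
    also have "\<dots> = (LINT \<omega>|M. LINT s|lborel. exponential_density 1 s * J (A \<omega>, s))"
    proof (rule Bochner_Integration.integral_cong[OF refl])
      fix \<omega> assume "\<omega> \<in> space M"
      then have "A \<omega> \<in> space S" using AM by (rule measurable_space[rotated])
      then have Js: "(\<lambda>s. J (A \<omega>, s)) \<in> borel_measurable borel" using measurable_Pair2[OF Jm] by simp
      have "(LINT s|D2. J (A \<omega>, s)) = (LINT \<omega>'|M. J (A \<omega>, gap n \<omega>'))"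
        unfolding D2_def by (rule integral_distr[OF gM Js])
      also have "\<dots> = (LINT s|lborel. exponential_density 1 s * J (A \<omega>, s))"
        by (rule distributed_integral[OF gap_exponential, symmetric]) (use Js in \<open>auto simp: exponential_density_def\<close>)
      finally show "(LINT s|D2. J (A \<omega>, s)) = (LINT s|lborel. exponential_density 1 s * J (A \<omega>, s))" .
    qed
    finally show ?thesis .
  qed
  finally show ?thesis by (simp add: J_def)
qed

text \<open>The factor \<open>exp (\<tau> n)\<close> compensates the density \<open>exp (- \<tau> n)\<close> contributed by the first \<open>n\<close>
  waiting times; it is what makes \<open>K\<close> itself, and not a discounted version of it, appear in the recursion below.\<close>

definition moment :: "real ^ 'd \<Rightarrow> nat \<Rightarrow> (real \<Rightarrow> real ^ 'd \<Rightarrow> real) \<Rightarrow> real"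
  where "moment x n h = (LINT \<omega>|M. exp (\<tau> n \<omega>) * h (t - \<tau> n \<omega>) (place (\<lambda>_. x) n \<omega>) * weight (\<lambda>_. x) n \<omega>)"

text \<open>The last step of the walk is integrated out. In
  \<open>exp (\<tau> (n + 1)) = exp (\<tau> n) * exp s\<close> the second factor cancels against the density \<open>exp (- s)\<close> of the
  last waiting time \<open>s\<close>, which leaves Lebesgue measure in \<open>s\<close>, as in the definition of \<open>K\<close>. Since \<open>h\<close>
  vanishes at negative times, only walks with \<open>\<tau> (n + 1) \<le> t\<close> count, and there the integrand is
  bounded.\<close>

lemma moment_Suc:
  assumes h: "kern.admissible h" and h0: "\<And>r z. r < 0 \<Longrightarrow> h r z = 0"
  shows "moment x (Suc n) h = moment x n (kern.K h)"
proof -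
  let ?p = "place (\<lambda>_. x)" and ?w = "weight (\<lambda>_. x)"
  obtain B where B: "\<And>r z. r \<le> T \<Longrightarrow> \<bar>h r z\<bar> \<le> B" using h by (auto simp: kern.admissible_def)
  have B0: "0 \<le> B" using B[of 0 0] kern.T_pos by auto
  let ?A = "\<lambda>\<omega>. (\<tau> n \<omega>, ?p n \<omega>, ?w n \<omega>)"
  define f :: "((real \<times> (real ^ 'd) \<times> real) \<times> real) \<times> (real ^ 'd) \<Rightarrow> real" where
    "f q = (case q of (((a, p, w), s), y) \<Rightarrow>
       exp (a + s) * h (t - (a + s)) (p + y) * (w * (m s * V (t - (a + s)) (p + y))))" for q
  note [measurable] = kern.admissible_measurable[OF h] kern.V_meas kern.m_meas
  have fm: "f \<in> borel_measurable (((borel \<Otimes>\<^sub>M borel \<Otimes>\<^sub>M borel) \<Otimes>\<^sub>M borel) \<Otimes>\<^sub>M borel)"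
    unfolding f_def by measurable
  have Am: "?A \<in> measurable (history n) (borel \<Otimes>\<^sub>M borel \<Otimes>\<^sub>M borel)"
    using \<tau>_history[OF order_refl] place_history weight_history by (intro measurable_Pair)
  have feq: "f ((?A \<omega>, gap n \<omega>), Xc (Suc n) (gap n \<omega>) \<omega>) =
      exp (\<tau> (Suc n) \<omega>) * h (t - \<tau> (Suc n) \<omega>) (?p (Suc n) \<omega>) * ?w (Suc n) \<omega>" for \<omega>
  proof -
    have "\<tau> n \<omega> + gap n \<omega> = \<tau> (Suc n) \<omega>" by (simp add: gap_def)
    then show ?thesis by (simp add: f_def)
  qed
  have int: "integrable M (\<lambda>\<omega>. f ((?A \<omega>, gap n \<omega>), Xc (Suc n) (gap n \<omega>) \<omega>))"
    unfolding feq
  proof (rule integrable_const_bound[where B="exp T * B * (Cm * Cv) ^ Suc n"])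
    have [measurable]: "?p (Suc n) \<in> borel_measurable M" "?w (Suc n) \<in> borel_measurable M" "\<tau> (Suc n) \<in> borel_measurable M"
      by (auto intro: place_measurable weight_measurable \<tau>_measurable simp del: place.simps weight.simps)
    show "(\<lambda>\<omega>. exp (\<tau> (Suc n) \<omega>) * h (t - \<tau> (Suc n) \<omega>) (?p (Suc n) \<omega>) * ?w (Suc n) \<omega>) \<in> borel_measurable M"
      by measurable
    show "AE \<omega> in M. norm (exp (\<tau> (Suc n) \<omega>) * h (t - \<tau> (Suc n) \<omega>) (?p (Suc n) \<omega>) * ?w (Suc n) \<omega>)
        \<le> exp T * B * (Cm * Cv) ^ Suc n"
    proof (rule AE_I2)
      fix \<omega> assume \<omega>: "\<omega> \<in> space M"
      have "exp (\<tau> (Suc n) \<omega>) * \<bar>h (t - \<tau> (Suc n) \<omega>) (?p (Suc n) \<omega>)\<bar> \<le> exp T * B"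
      proof (cases "\<tau> (Suc n) \<omega> \<le> t")
        case True
        then show ?thesis using t \<tau>_nonneg[OF \<omega>, of "Suc n"] by (intro mult_mono B) auto
      next
        case False
        then show ?thesis using B0 by (simp add: h0)
      qed
      then show "norm (exp (\<tau> (Suc n) \<omega>) * h (t - \<tau> (Suc n) \<omega>) (?p (Suc n) \<omega>) * ?w (Suc n) \<omega>)
        \<le> exp T * B * (Cm * Cv) ^ Suc n"
        unfolding real_norm_def abs_mult[of _ "?w (Suc n) \<omega>"] abs_mult[of "exp _"] abs_exp_cancel
        by (rule mult_mono[OF _ weight_bound]) (use B0 in \<open>auto simp del: weight.simps place.simps\<close>)
    qed
  qed
  have "moment x (Suc n) h = (LINT \<omega>|M. f ((?A \<omega>, gap n \<omega>), Xc (Suc n) (gap n \<omega>) \<omega>))"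
    unfolding moment_def feq ..
  also have "\<dots> = (LINT \<omega>|M. (LINT s|lborel. exponential_density 1 s * (LINT \<omega>'|M0. f ((?A \<omega>, s), Y s \<omega>'))))"
    by (rule next_step_integral[OF Am fm int])
  also have "\<dots> = moment x n (kern.K h)"
    unfolding moment_def
  proof (rule Bochner_Integration.integral_cong[OF refl])
    fix \<omega>
    have "exponential_density 1 s * (LINT \<omega>'|M0. f ((?A \<omega>, s), Y s \<omega>')) =
        (exp (\<tau> n \<omega>) * ?w n \<omega>) * (m s * kern.avg h (t - \<tau> n \<omega>) (?p n \<omega>) s)" for s
    proof -
      have "f ((?A \<omega>, s), Y s \<omega>') = (exp (\<tau> n \<omega> + s) * ?w n \<omega> * m s) *
          (V (t - \<tau> n \<omega> - s) (?p n \<omega> + Y s \<omega>') * h (t - \<tau> n \<omega> - s) (?p n \<omega> + Y s \<omega>'))" for \<omega>'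
        by (simp add: f_def diff_diff_eq mult_ac)
      then have avg: "(LINT \<omega>'|M0. f ((?A \<omega>, s), Y s \<omega>')) =
          (exp (\<tau> n \<omega> + s) * ?w n \<omega> * m s) * kern.avg h (t - \<tau> n \<omega>) (?p n \<omega>) s"
        unfolding kern.avg_def by simp
      have ed: "exponential_density 1 s * (exp (\<tau> n \<omega> + s) * m s) = exp (\<tau> n \<omega>) * m s"
        by (cases "s \<le> 0") (auto simp: kern.m_out exponential_density_def mult_exp_exp)
      have "exponential_density 1 s * ((exp (\<tau> n \<omega> + s) * ?w n \<omega> * m s) * kern.avg h (t - \<tau> n \<omega>) (?p n \<omega>) s) =
          (exponential_density 1 s * (exp (\<tau> n \<omega> + s) * m s)) * (?w n \<omega> * kern.avg h (t - \<tau> n \<omega>) (?p n \<omega>) s)"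
        by (simp only: mult_ac)
      then show ?thesis unfolding avg ed by (simp only: mult_ac)
    qed
    then show "(LINT s|lborel. exponential_density 1 s * (LINT \<omega>'|M0. f ((?A \<omega>, s), Y s \<omega>'))) =
        exp (\<tau> n \<omega>) * kern.K h (t - \<tau> n \<omega>) (?p n \<omega>) * ?w n \<omega>"
      by (simp add: kern.K_def)
  qed
  finally show ?thesis .
qed

lemma moment_0: "moment x 0 h = h t x"
proof -
  have "moment x 0 h = (LINT \<omega>|M. h t x)"
    unfolding moment_def by (rule Bochner_Integration.integral_cong) (auto simp: \<tau>_0)
  then show ?thesis by (simp add: prob_space)
qed

lemma moment_eq_iterate:
  assumes "kern.admissible h" "\<And>r z. r < 0 \<Longrightarrow> h r z = 0"
  shows "moment x n h = (kern.K ^^ n) h t x"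
  using assms
proof (induction n arbitrary: h)
  case (Suc n)
  have "moment x (Suc n) h = moment x n (kern.K h)" by (rule moment_Suc[OF Suc.prems])
  also have "\<dots> = (kern.K ^^ n) (kern.K h) t x"
    by (rule Suc.IH[OF kern.admissible_K[OF Suc.prems(1)]]) (simp add: kern.K_zero)
  finally show ?case by (simp add: funpow_swap1)
qed (simp add: moment_0)

text \<open>The factorial makes the contributions of the events \<open>{N t = n}\<close>, on which the integrand is bounded by a
  constant times \<open>(Cm * Cv) ^ n\<close>, summable.\<close>

lemma prob_N: "prob {\<omega>\<in>space M. N t \<omega> = n} \<le> t ^ n / fact n"
proof (cases "t = 0")
  case True
  have "{\<omega>\<in>space M. N t \<omega> = n} = (if n = 0 then space M else {})"
    using poisson True by (auto simp: poisson_process_def)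
  then show ?thesis using True by (simp add: prob_space)
next
  case False
  then have t0: "0 < t" using t by simp
  have [measurable]: "random_variable (count_space UNIV) (N t)"
    using poisson t by (auto simp: poisson_process_def)
  have z: "N 0 \<omega> = 0" if "\<omega> \<in> space M" for \<omega> using poisson that by (auto simp: poisson_process_def)
  have "prob {\<omega>\<in>space M. N t \<omega> = n} = measure (distr M (count_space UNIV) (\<lambda>\<omega>. N t \<omega> - N 0 \<omega>)) {n}"
  proof -
    have "distr M (count_space UNIV) (\<lambda>\<omega>. N t \<omega> - N 0 \<omega>) = distr M (count_space UNIV) (N t)"
      by (rule distr_cong) (auto simp: z)
    then show ?thesis by (simp add: measure_distr) (auto intro!: arg_cong[where f=prob])
  qed
  also have "\<dots> = measure (measure_pmf (poisson_pmf (1 * (t - 0)))) {n}"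
    using poisson t0 unfolding poisson_process_def by auto
  also have "\<dots> = t ^ n / fact n * exp (- t)" using t0 by (simp add: measure_pmf_single)
  also have "\<dots> \<le> t ^ n / fact n * 1" using t0 by (intro mult_left_mono) auto
  finally show ?thesis by simp
qed

lemma N_event: "{\<omega>\<in>space M. N t \<omega> = n} \<in> events"
proof -
  have [measurable]: "random_variable (count_space UNIV) (N t)"
    using poisson t by (auto simp: poisson_process_def)
  show ?thesis by measurable
qed

definition contribution :: "(real \<Rightarrow> real ^ 'd \<Rightarrow> real) \<Rightarrow> real ^ 'd \<Rightarrow> nat \<Rightarrow> 'w \<Rightarrow> real"
  where "contribution h x n \<omega> =
    indicator {\<omega>\<in>space M. N t \<omega> = n} \<omega> * (h (t - \<tau> n \<omega>) (place (\<lambda>_. x) n \<omega>) * weight (\<lambda>_. x) n \<omega>)"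

context
  fixes h B
  assumes h: "kern.admissible h" and h0: "\<And>r z. r < 0 \<Longrightarrow> h r z = 0"
    and B: "\<And>r z. r \<le> T \<Longrightarrow> \<bar>h r z\<bar> \<le> B"
begin

lemma contribution_measurable: "contribution h x n \<in> borel_measurable M"
proof -
  have [measurable]: "place (\<lambda>_. x) n \<in> borel_measurable M" "weight (\<lambda>_. x) n \<in> borel_measurable M" "\<tau> n \<in> borel_measurable M"
    by (auto intro: place_measurable weight_measurable \<tau>_measurable)
  note [measurable] = kern.admissible_measurable[OF h] N_event
  show ?thesis unfolding contribution_def by measurable
qed

lemma contribution_bound:
  assumes \<omega>: "\<omega> \<in> space M"
  shows "\<bar>contribution h x n \<omega>\<bar> \<le> indicator {\<omega>\<in>space M. N t \<omega> = n} \<omega> * (B * (Cm * Cv) ^ n)"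
proof -
  have B0: "0 \<le> B" using B[of 0 0] kern.T_pos by auto
  have "\<bar>h (t - \<tau> n \<omega>) (place (\<lambda>_. x) n \<omega>)\<bar> * \<bar>weight (\<lambda>_. x) n \<omega>\<bar> \<le> B * (Cm * Cv) ^ n"
    using t \<tau>_nonneg[OF \<omega>, of n] B0 by (intro mult_mono B weight_bound) auto
  then show ?thesis by (auto simp: contribution_def abs_mult indicator_def)
qed

lemma contribution_integrable: "integrable M (contribution h x n)"
proof (rule integrable_const_bound[OF _ contribution_measurable])
  have B0: "0 \<le> B" using B[of 0 0] kern.T_pos by auto
  show "AE \<omega> in M. norm (contribution h x n \<omega>) \<le> B * (Cm * Cv) ^ n"
  proof (rule AE_I2)
    fix \<omega> assume "\<omega> \<in> space M"
    moreover have "0 \<le> B * (Cm * Cv) ^ n" using B0 kern.Cm_nonneg kern.Cv_nonneg by simp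
    ultimately show "norm (contribution h x n \<omega>) \<le> B * (Cm * Cv) ^ n"
      using contribution_bound[of \<omega> x n] by (cases "N t \<omega> = n") auto
  qed
qed

text \<open>The event \<open>N t = n\<close> means \<open>\<tau> n \<le> t\<close> and \<open>t - \<tau> n < gap n\<close>. The first condition is implied where \<open>h\<close>
  does not vanish, and the second has conditional probability \<open>exp (- (t - \<tau> n))\<close>.\<close>

lemma expectation_contribution: "expectation (contribution h x n) = exp (- t) * moment x n h"
proof -
  let ?p = "place (\<lambda>_. x)" and ?w = "weight (\<lambda>_. x)"
  let ?A = "\<lambda>\<omega>. (\<tau> n \<omega>, ?p n \<omega>, ?w n \<omega>)"
  define f :: "((real \<times> (real ^ 'd) \<times> real) \<times> real) \<times> (real ^ 'd) \<Rightarrow> real" where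
    "f q = (case q of (((a, p, w), s), y) \<Rightarrow> indicator {0<..} (a + s - t) * (h (t - a) p * w))" for q
  note [measurable] = kern.admissible_measurable[OF h]
  have fm: "f \<in> borel_measurable (((borel \<Otimes>\<^sub>M borel \<Otimes>\<^sub>M borel) \<Otimes>\<^sub>M borel) \<Otimes>\<^sub>M borel)"
    unfolding f_def by measurable
  have Am: "?A \<in> measurable (history n) (borel \<Otimes>\<^sub>M borel \<Otimes>\<^sub>M borel)"
    using \<tau>_history[OF order_refl] place_history weight_history by (intro measurable_Pair)
  have feq: "f ((?A \<omega>, gap n \<omega>), Xc (Suc n) (gap n \<omega>) \<omega>) = contribution h x n \<omega>" if "\<omega> \<in> space M" for \<omega>
    using N_eq_iff[OF that t(1), of n] that
    by (cases "\<tau> n \<omega> \<le> t") (auto simp: f_def contribution_def indicator_def gap_def h0)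
  have int: "integrable M (\<lambda>\<omega>. f ((?A \<omega>, gap n \<omega>), Xc (Suc n) (gap n \<omega>) \<omega>))"
    using contribution_integrable[of x n] by (subst Bochner_Integration.integrable_cong[OF refl feq]) auto
  have "expectation (contribution h x n) = (LINT \<omega>|M. f ((?A \<omega>, gap n \<omega>), Xc (Suc n) (gap n \<omega>) \<omega>))"
    by (rule Bochner_Integration.integral_cong[OF refl feq[symmetric]])
  also have "\<dots> = (LINT \<omega>|M. (LINT s|lborel. exponential_density 1 s * (LINT \<omega>'|M0. f ((?A \<omega>, s), Y s \<omega>'))))"
    by (rule next_step_integral[OF Am fm int])
  also have "\<dots> = (LINT \<omega>|M. exp (- t) * (exp (\<tau> n \<omega>) * h (t - \<tau> n \<omega>) (?p n \<omega>) * ?w n \<omega>))"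
  proof (rule Bochner_Integration.integral_cong[OF refl])
    fix \<omega>
    let ?r = "t - \<tau> n \<omega>"
    have "(LINT s|lborel. exponential_density 1 s * (LINT \<omega>'|M0. f ((?A \<omega>, s), Y s \<omega>')))
        = (LINT s|lborel. (exponential_density 1 s * indicator {?r<..} s) * (h ?r (?p n \<omega>) * ?w n \<omega>))"
      by (rule Bochner_Integration.integral_cong)
         (auto simp: f_def kern.prob_space indicator_def)
    also have "\<dots> = (LINT s|lborel. exponential_density 1 s * indicator {?r<..} s) * (h ?r (?p n \<omega>) * ?w n \<omega>)"
      by simp
    also have "\<dots> = exp (- ?r) * (h ?r (?p n \<omega>) * ?w n \<omega>)"
    proof (cases "0 \<le> ?r")
      case True
      have "(LINT s|lborel. exponential_density 1 s * indicator {?r<..} s) = (LINT \<omega>'|M. indicator {?r<..} (gap n \<omega>'))"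
        by (rule distributed_integral[OF gap_exponential]) (auto simp: exponential_density_def)
      also have "\<dots> = (LINT \<omega>'|M. indicator {\<omega>'\<in>space M. ?r < gap n \<omega>'} \<omega>')"
        by (rule Bochner_Integration.integral_cong) (auto simp: indicator_def)
      also have "\<dots> = exp (- ?r)"
        using gap_measurable[measurable] by (simp add: prob_gap_greater[OF True])
      finally show ?thesis by simp
    qed (simp add: h0)
    also have "\<dots> = exp (- t) * (exp (\<tau> n \<omega>) * h ?r (?p n \<omega>) * ?w n \<omega>)"
      by (simp add: exp_diff exp_minus field_simps)
    finally show "(LINT s|lborel. exponential_density 1 s * (LINT \<omega>'|M0. f ((?A \<omega>, s), Y s \<omega>')))
        = exp (- t) * (exp (\<tau> n \<omega>) * h ?r (?p n \<omega>) * ?w n \<omega>)" .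
  qed
  finally show ?thesis by (simp add: moment_def)
qed

text \<open>The expectation is split according to the value of \<open>N t\<close>, and the part on \<open>{N t = n}\<close> is the \<open>n\<close>-th
  term of the Neumann series times \<open>exp (- t)\<close>.\<close>

lemma walk_represents_solution:
  "exp t * (LINT \<omega>|M. h (t - \<tau> (N t \<omega>) \<omega>) (place (\<lambda>_. x) (N t \<omega>) \<omega>) * weight (\<lambda>_. x) (N t \<omega>) \<omega>)
     = kern.solution h t x"
proof -
  have fin: "contribution h x n \<omega> = 0" if "n \<notin> {N t \<omega>}" for n \<omega>
    using that by (simp add: contribution_def)
  have sums: "(\<lambda>n. expectation (contribution h x n)) sums (LINT \<omega>|M. (\<Sum>n. contribution h x n \<omega>))"
  proof (rule sums_integral[OF contribution_integrable])
    show "AE \<omega> in M. summable (\<lambda>n. norm (contribution h x n \<omega>))"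
    proof (rule AE_I2)
      show "summable (\<lambda>n. norm (contribution h x n \<omega>))" for \<omega>
        by (rule summable_finite[of "{N t \<omega>}"]) (auto simp: fin)
    qed
    show "summable (\<lambda>n. LINT \<omega>|M. norm (contribution h x n \<omega>))"
    proof (rule summable_comparison_test')
      show "summable (\<lambda>n. B * ((Cm * Cv * t) ^ n / fact n))"
        using summable_exp[of "Cm * Cv * t"] by (intro summable_mult) (simp add: field_simps)
      fix n
      have "(LINT \<omega>|M. norm (contribution h x n \<omega>)) \<le> (LINT \<omega>|M. indicator {\<omega>\<in>space M. N t \<omega> = n} \<omega> * (B * (Cm * Cv) ^ n))"
      proof (rule integral_mono)
        show "integrable M (\<lambda>\<omega>. norm (contribution h x n \<omega>))" by (rule integrable_norm[OF contribution_integrable])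
        show "integrable M (\<lambda>\<omega>. indicator {\<omega>\<in>space M. N t \<omega> = n} \<omega> * (B * (Cm * Cv) ^ n))"
          using N_event by (intro integrable_mult_left integrable_real_indicator) (auto simp: less_top[symmetric])
        show "norm (contribution h x n \<omega>) \<le> indicator {\<omega>\<in>space M. N t \<omega> = n} \<omega> * (B * (Cm * Cv) ^ n)"
          if "\<omega> \<in> space M" for \<omega> using contribution_bound[OF that] by simp
      qed
      also have "\<dots> = prob {\<omega>\<in>space M. N t \<omega> = n} * (B * (Cm * Cv) ^ n)"
        using N_event by simp
      also have "\<dots> \<le> t ^ n / fact n * (B * (Cm * Cv) ^ n)"
        using prob_N B[of 0 0] kern.T_pos kern.Cm_nonneg kern.Cv_nonneg by (intro mult_right_mono) auto
      finally show "norm (LINT \<omega>|M. norm (contribution h x n \<omega>)) \<le> B * ((Cm * Cv * t) ^ n / fact n)"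
        by (simp add: power_mult_distrib mult_ac)
    qed
  qed
  have "(LINT \<omega>|M. h (t - \<tau> (N t \<omega>) \<omega>) (place (\<lambda>_. x) (N t \<omega>) \<omega>) * weight (\<lambda>_. x) (N t \<omega>) \<omega>)
      = (LINT \<omega>|M. (\<Sum>n. contribution h x n \<omega>))"
  proof (rule Bochner_Integration.integral_cong[OF refl])
    fix \<omega> assume "\<omega> \<in> space M"
    moreover have "(\<Sum>n. contribution h x n \<omega>) = (\<Sum>n\<in>{N t \<omega>}. contribution h x n \<omega>)"
      by (rule suminf_finite) (auto simp: fin)
    ultimately show "h (t - \<tau> (N t \<omega>) \<omega>) (place (\<lambda>_. x) (N t \<omega>) \<omega>) * weight (\<lambda>_. x) (N t \<omega>) \<omega> = (\<Sum>n. contribution h x n \<omega>)"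
      by (simp add: contribution_def)
  qed
  also have "\<dots> = (\<Sum>n. exp (- t) * (kern.K ^^ n) h t x)"
    using sums by (simp add: sums_iff expectation_contribution moment_eq_iterate[OF h h0])
  also have "\<dots> = exp (- t) * (\<Sum>n. (kern.K ^^ n) h t x)"
    by (rule suminf_mult[OF kern.summable_iterates[OF h B t]]) auto
  also have "(\<Sum>n. (kern.K ^^ n) h t x) = kern.solution h t x"
    using t by (simp add: kern.solution_def)
  finally show ?thesis by (simp add: exp_minus)
qed

lemma walk_from_start_represents_solution:
  assumes \<xi>: "\<xi> \<in> borel_measurable M" and start: "AE \<omega> in M. \<xi> \<omega> = x"
  shows "exp t * (LINT \<omega>|M. h (t - \<tau> (N t \<omega>) \<omega>) (place \<xi> (N t \<omega>) \<omega>) * weight \<xi> (N t \<omega>) \<omega>)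
     = kern.solution h t x"
proof -
  have meas: "(\<lambda>\<omega>. h (t - \<tau> (N t \<omega>) \<omega>) (place \<xi>' (N t \<omega>) \<omega>) * weight \<xi>' (N t \<omega>) \<omega>) \<in> borel_measurable M"
    if "\<xi>' \<in> borel_measurable M" for \<xi>'
  proof (rule measurable_compose_countable[where g="N t"])
    show "random_variable (count_space UNIV) (N t)" using poisson t by (auto simp: poisson_process_def)
    fix n
    note [measurable] = place_measurable[OF that] weight_measurable[OF that] \<tau>_measurable kern.admissible_measurable[OF h]
    show "(\<lambda>\<omega>. h (t - \<tau> n \<omega>) (place \<xi>' n \<omega>) * weight \<xi>' n \<omega>) \<in> borel_measurable M" by measurable
  qed
  have "(LINT \<omega>|M. h (t - \<tau> (N t \<omega>) \<omega>) (place \<xi> (N t \<omega>) \<omega>) * weight \<xi> (N t \<omega>) \<omega>) =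
      (LINT \<omega>|M. h (t - \<tau> (N t \<omega>) \<omega>) (place (\<lambda>_. x) (N t \<omega>) \<omega>) * weight (\<lambda>_. x) (N t \<omega>) \<omega>)"
  proof (rule integral_cong_AE[OF meas[OF \<xi>] meas])
    show "AE \<omega> in M. h (t - \<tau> (N t \<omega>) \<omega>) (place \<xi> (N t \<omega>) \<omega>) * weight \<xi> (N t \<omega>) \<omega> =
      h (t - \<tau> (N t \<omega>) \<omega>) (place (\<lambda>_. x) (N t \<omega>) \<omega>) * weight (\<lambda>_. x) (N t \<omega>) \<omega>"
      using start
    proof eventually_elim
      case (elim \<omega>)
      from start_cong[of \<xi> \<omega> "\<lambda>_. x", OF elim] show ?case by simp
    qed
  qed simp
  then show ?thesis by (simp only: walk_represents_solution)
qed

end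

end

section \<open>The probabilistic representation\<close>

text \<open>The coefficients are prescribed on \<open>[0, T]\<close> only. Extending them by zero makes them Borel functions on
  the whole line and builds the constraint that the jumps occur before time \<open>t\<close> into their values.\<close>

definition restrict_time :: "real \<Rightarrow> (real \<Rightarrow> 'a \<Rightarrow> real) \<Rightarrow> real \<Rightarrow> 'a \<Rightarrow> real"
  where "restrict_time T f r z = (if 0 \<le> r \<and> r \<le> T then f r z else 0)"

lemma restrict_time_eq: "r \<in> {0..T} \<Longrightarrow> restrict_time T f r = f r"
  by (auto simp: restrict_time_def)

lemma restrict_time_measurable:
  assumes T: "0 \<le> T" and f: "(\<lambda>(r, z). f r z) \<in> borel_measurable (restrict_space borel {0..T} \<Otimes>\<^sub>M L)"
  shows "(\<lambda>(r, z). restrict_time T f r z) \<in> borel_measurable (borel \<Otimes>\<^sub>M L)"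
proof -
  have [measurable]: "(\<lambda>r. max 0 (min T r)) \<in> measurable borel (restrict_space borel {0..T})"
    using T by (intro measurable_restrict_space2) auto
  have "(\<lambda>q. (max 0 (min T (fst q)), snd q)) \<in> measurable (borel \<Otimes>\<^sub>M L) (restrict_space borel {0..T} \<Otimes>\<^sub>M L)"
    by measurable
  from measurable_compose[OF this f]
  have [measurable]: "(\<lambda>q. f (max 0 (min T (fst q))) (snd q)) \<in> borel_measurable (borel \<Otimes>\<^sub>M L)" by simp
  have "(\<lambda>q. if 0 \<le> fst q \<and> fst q \<le> T then f (max 0 (min T (fst q))) (snd q) else 0) \<in> borel_measurable (borel \<Otimes>\<^sub>M L)"
    by measurable
  also have "(\<lambda>q. if 0 \<le> fst q \<and> fst q \<le> T then f (max 0 (min T (fst q))) (snd q) else 0) = (\<lambda>(r, z). restrict_time T f r z)"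
    by (auto simp: restrict_time_def fun_eq_iff)
  finally show ?thesis .
qed

text \<open>Extends a process indexed by positive times to all real times. Being constant at the new times, the
  extension preserves both joint measurability and equality of the laws at each time.\<close>

definition from_zero :: "(real \<Rightarrow> 'w \<Rightarrow> real ^ 'd) \<Rightarrow> real \<Rightarrow> 'w \<Rightarrow> real ^ 'd"
  where "from_zero X s \<omega> = (if 0 < s then X s \<omega> else 0)"

lemma from_zero_measurable:
  assumes "jointly_measurable_process M X"
  shows "(\<lambda>(s, \<omega>). from_zero X s \<omega>) \<in> borel_measurable (borel \<Otimes>\<^sub>M M)"
proof -
  have f: "(\<lambda>(s, \<omega>). X s \<omega>) \<in> borel_measurable (restrict_space borel {0<..} \<Otimes>\<^sub>M M)"
    using assms by (simp add: jointly_measurable_process_def)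
  have [measurable]: "(\<lambda>s. if 0 < s then s else 1) \<in> measurable borel (restrict_space borel {(0::real)<..})"
    by (intro measurable_restrict_space2) auto
  have "(\<lambda>q. (if 0 < fst q then fst q else 1, snd q)) \<in> measurable (borel \<Otimes>\<^sub>M M) (restrict_space borel {(0::real)<..} \<Otimes>\<^sub>M M)"
    by (intro measurable_Pair measurable_compose[OF measurable_fst]) measurable
  from measurable_compose[OF this f]
  have [measurable]: "(\<lambda>q. X (if 0 < fst q then fst q else 1) (snd q)) \<in> borel_measurable (borel \<Otimes>\<^sub>M M)" by simp
  have "(\<lambda>q. if 0 < fst q then X (if 0 < fst q then fst q else 1) (snd q) else 0) \<in> borel_measurable (borel \<Otimes>\<^sub>M M)"
    by measurable
  also have "(\<lambda>q. if 0 < fst q then X (if 0 < fst q then fst q else 1) (snd q) else 0) = (\<lambda>(s, \<omega>). from_zero X s \<omega>)"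
    by (auto simp: from_zero_def fun_eq_iff)
  finally show ?thesis .
qed

lemma process_coordinate_measurable:
  assumes "jointly_measurable_process M X" "0 < s"
  shows "X s \<in> borel_measurable M"
proof -
  have "from_zero X s \<in> borel_measurable M"
    using measurable_Pair2[OF from_zero_measurable[OF assms(1)], of s] by simp
  moreover have "from_zero X s = X s" using assms(2) by (auto simp: from_zero_def)
  ultimately show ?thesis by simp
qed

lemma process_law_coordinate:
  assumes X: "\<And>s. 0 < s \<Longrightarrow> X s \<in> borel_measurable M" and s: "0 < s"
  shows "distr (process_law M X) borel (\<lambda>f. f s) = distr M borel (X s)"
proof -
  have 1: "(\<lambda>f. f s) \<in> measurable (\<Pi>\<^sub>M t\<in>{0<..}. borel) borel"
    using s by (intro measurable_component_singleton) auto
  have 2: "(\<lambda>\<omega>. \<lambda>t\<in>{0<..}. X t \<omega>) \<in> measurable M (\<Pi>\<^sub>M t\<in>{0<..}. borel)"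
    using X by (intro measurable_restrict) auto
  show ?thesis
    unfolding process_law_def distr_distr[OF 1 2] by (rule distr_cong) (use s in auto)
qed

lemma distr_from_zero_eq:
  assumes M: "prob_space M" and M': "prob_space M'"
    and X: "\<And>s. 0 < s \<Longrightarrow> X s \<in> borel_measurable M" and X': "\<And>s. 0 < s \<Longrightarrow> X' s \<in> borel_measurable M'"
    and law: "process_law M X = process_law M' X'"
  shows "distr M borel (from_zero X s) = distr M' borel (from_zero X' s)"
proof (cases "0 < s")
  case True
  then have "from_zero X s = X s" "from_zero X' s = X' s" by (auto simp: from_zero_def)
  then show ?thesis using process_law_coordinate[of X M, OF X True] process_law_coordinate[of X' M', OF X' True] law by simp
next
  case False
  then have "from_zero X s = (\<lambda>_. 0)" "from_zero X' s = (\<lambda>_. 0)" by (auto simp: from_zero_def)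
  then show ?thesis by (simp add: prob_space.distr_const[OF M] prob_space.distr_const[OF M'])
qed

text \<open>Since \<open>\<mu>\<close> is finite and not zero, it is recovered from the law of \<open>- \<xi>\<close> as a multiple of it.\<close>

lemma integral_by_normalised_law:
  fixes \<mu> :: "(real ^ 'd) measure" and g :: "real ^ 'd \<Rightarrow> real"
  assumes M0: "prob_space M0" and \<mu>: "sets \<mu> = sets borel" "emeasure \<mu> UNIV < \<infinity>" "0 < emeasure \<mu> UNIV"
    and \<xi>[measurable]: "\<xi> \<in> borel_measurable M0"
    and law: "\<And>D. D \<in> sets borel \<Longrightarrow> measure M0 {\<omega>\<in>space M0. - \<xi> \<omega> \<in> D} = measure \<mu> D / measure \<mu> UNIV"
    and g[measurable]: "g \<in> borel_measurable borel"
  shows "(LINT y|\<mu>. g (x - y)) = measure \<mu> UNIV * (LINT \<omega>|M0. g (x + \<xi> \<omega>))"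
proof -
  interpret prob_space M0 by fact
  have sp: "space \<mu> = UNIV" using sets_eq_imp_space_eq[OF \<mu>(1)] by simp
  interpret \<mu>: finite_measure \<mu> by (rule finite_measureI) (use \<mu>(2) in \<open>simp add: sp less_top\<close>)
  let ?c = "measure \<mu> UNIV"
  have c: "0 < ?c" using \<mu>(3) by (simp add: \<mu>.emeasure_eq_measure)
  let ?D = "distr M0 borel (\<lambda>\<omega>. - \<xi> \<omega>)"
  have "\<mu> = density ?D (\<lambda>_. ennreal ?c)"
  proof (rule measure_eqI)
    fix A assume "A \<in> sets \<mu>"
    then have A[measurable]: "A \<in> sets borel" by (simp add: \<mu>(1))
    have "(\<lambda>\<omega>. - \<xi> \<omega>) -` A \<inter> space M0 = {\<omega>\<in>space M0. - \<xi> \<omega> \<in> A}" by auto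
    then have "emeasure ?D A = ennreal (measure \<mu> A / ?c)"
      by (simp add: emeasure_distr emeasure_eq_measure law)
    then show "emeasure \<mu> A = emeasure (density ?D (\<lambda>_. ennreal ?c)) A"
      using c by (simp add: emeasure_density_const \<mu>.emeasure_eq_measure flip: ennreal_mult)
  qed (simp add: \<mu>(1))
  then have "(LINT y|\<mu>. g (x - y)) = (LINT y|density ?D (\<lambda>_. ennreal ?c). g (x - y))" by simp
  also have "\<dots> = (LINT y|?D. ?c * g (x - y))"
    by (subst integral_real_density) auto
  also have "\<dots> = ?c * (LINT y|?D. g (x - y))" by simp
  also have "(LINT y|?D. g (x - y)) = (LINT \<omega>|M0. g (x + \<xi> \<omega>))"
    by (subst integral_distr) auto
  finally show ?thesis .
qed

text \<open>
  Every bounded solution agrees on \<open>[0, T]\<close> with the Neumann series, and so does \<open>u\<close>: for each \<open>x\<close> the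
  sigma-algebras that witness independence under \<open>P x\<close> may differ, but the limit of the series does
  not depend on them.
\<close>

theorem theorem3p2:
  fixes T :: real
    and S :: "real \<Rightarrow> (real ^ 'd) measure"
    and M0 :: "'o measure" and Xt :: "real \<Rightarrow> 'o \<Rightarrow> real ^ 'd"
    and V w u :: "real \<Rightarrow> real ^ 'd \<Rightarrow> real"
    and \<Omega> :: "'w measure" and P :: "real ^ 'd \<Rightarrow> 'w measure"
    and Xc :: "nat \<Rightarrow> real \<Rightarrow> 'w \<Rightarrow> real ^ 'd"
    and N :: "real \<Rightarrow> 'w \<Rightarrow> nat" and \<tau> :: "nat \<Rightarrow> 'w \<Rightarrow> real"
    and X :: "real \<Rightarrow> 'w \<Rightarrow> real ^ 'd"
  assumes T: "T > 0"
    and S_sets: "\<And>t. t \<ge> 0 \<Longrightarrow> sets (S t) = sets borel"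
    and S_kernel: "\<And>A. A \<in> sets borel \<Longrightarrow>
          (\<lambda>t. emeasure (S t) A) \<in> borel_measurable (restrict_space borel {0..})"
    and S_pos: "\<And>t. t > 0 \<Longrightarrow> emeasure (S t) UNIV > 0"
    and A: "\<And>T'. T' > 0 \<Longrightarrow> (SUP t\<in>{0..T'}. emeasure (S t) UNIV) < \<infinity>"
    and B_space: "prob_space M0"
    and B_meas: "jointly_measurable_process M0 Xt"
    and B_law: "\<And>t D. t > 0 \<Longrightarrow> D \<in> sets borel \<Longrightarrow>
          measure M0 {\<omega> \<in> space M0. - Xt t \<omega> \<in> D} = measure (S t) D / measure (S t) UNIV"
    and V_meas: "(\<lambda>(t, x). V t x) \<in> borel_measurable (restrict_space borel {0..T} \<Otimes>\<^sub>M borel)"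
    and V_bdd: "bounded ((\<lambda>(t, x). V t x) ` ({0..T} \<times> UNIV))"
    and w_meas: "(\<lambda>(t, x). w t x) \<in> borel_measurable (restrict_space borel {0..T} \<Otimes>\<^sub>M borel)"
    and w_bdd: "bounded ((\<lambda>(t, x). w t x) ` ({0..T} \<times> UNIV))"
    and jumps: "jump_times (space \<Omega>) N \<tau>"
    and X0_meas: "X 0 \<in> borel_measurable \<Omega>"
    and X_constr: "concatenated_at (space \<Omega>) \<tau> Xc X"
    and P_sets: "\<And>x. sets (P x) = sets \<Omega>"
    and P_prob: "\<And>x. prob_space (P x)"
    and P_poisson: "\<And>x. poisson_process (P x) 1 N"
    and P_copies: "\<And>x. iid_copies_indep_of (P x) M0 Xt Xc N"
    and P_start: "\<And>x. AE \<omega> in P x. X 0 \<omega> = x"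
    and u_def: "\<And>t x. t \<in> {0..T} \<Longrightarrow>
          u t x = exp t * (LINT \<omega>|P x.
            w (t - \<tau> (N t \<omega>) \<omega>) (X (\<tau> (N t \<omega>) \<omega>) \<omega>) *
            (\<Prod>i=1..N t \<omega>.
               measure (S (\<tau> i \<omega> - \<tau> (i - 1) \<omega>)) UNIV * V (t - \<tau> i \<omega>) (X (\<tau> i \<omega>) \<omega>)))"
  shows "the_bounded_solution T S V w u"
proof -
  define Y where "Y = from_zero Xt"
  define m where "m s = (if 0 < s \<and> s \<le> T then measure (S s) UNIV else 0)" for s
  define Cm where "Cm = enn2real (SUP t\<in>{0..T}. emeasure (S t) UNIV)"
  have S_le: "emeasure (S s) UNIV \<le> (SUP t\<in>{0..T}. emeasure (S t) UNIV)" if "0 \<le> s" "s \<le> T" for s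
    using that by (intro SUP_upper) auto
  have S_fin: "emeasure (S s) UNIV < \<infinity>" if "0 \<le> s" "s \<le> T" for s
    using S_le[OF that] A[OF T] by (rule order.strict_trans1)
  obtain Cv where Cv: "\<And>r z. r \<in> {0..T} \<Longrightarrow> \<bar>V r z\<bar> \<le> Cv"
    using V_bdd unfolding bounded_iff by force
  obtain B where B: "\<And>r z. r \<in> {0..T} \<Longrightarrow> \<bar>w r z\<bar> \<le> B"
    using w_bdd unfolding bounded_iff by force
  have Cv0: "0 \<le> Cv" and B0: "0 \<le> B" using Cv[of 0 0] B[of 0 0] T by auto
  have m_meas: "m \<in> borel_measurable borel"
  proof -
    have "(\<lambda>s. max 0 s) \<in> measurable borel (restrict_space borel {(0::real)..})"
      by (intro measurable_restrict_space2) auto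
    from measurable_compose[OF this S_kernel[of UNIV]]
    have [measurable]: "(\<lambda>s. emeasure (S (max 0 s)) UNIV) \<in> borel_measurable borel" by simp
    have "m = (\<lambda>s. if 0 < s \<and> s \<le> T then enn2real (emeasure (S (max 0 s)) UNIV) else 0)"
      by (auto simp: m_def measure_def fun_eq_iff)
    then show ?thesis by simp
  qed
  interpret M0: prob_space M0 by (rule B_space)
  interpret kern: jump_kernel M0 Y m "restrict_time T V" T Cm Cv
  proof (unfold_locales)
    show "(\<lambda>(s, \<omega>). Y s \<omega>) \<in> borel_measurable (borel \<Otimes>\<^sub>M M0)"
      unfolding Y_def by (rule from_zero_measurable[OF B_meas])
    show "(\<lambda>(r, z). restrict_time T V r z) \<in> borel_measurable (borel \<Otimes>\<^sub>M borel)"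
      using T by (intro restrict_time_measurable V_meas) simp
    show "\<bar>m s\<bar> \<le> Cm" for s
    proof (cases "0 < s \<and> s \<le> T")
      case True
      then show ?thesis
        using S_le[of s] A[OF T] unfolding m_def Cm_def measure_def by (auto intro!: enn2real_mono)
    qed (auto simp: m_def Cm_def)
    show "\<bar>restrict_time T V r z\<bar> \<le> Cv" for r z using Cv[of r z] Cv0 by (auto simp: restrict_time_def)
    show "0 < T" "m \<in> borel_measurable borel" by (fact T m_meas)+
    show "m s = 0" if "s \<le> 0" for s using that by (simp add: m_def)
    show "restrict_time T V r z = 0" if "r < 0" for r z using that by (simp add: restrict_time_def)
  qed
  have w: "kern.admissible (restrict_time T w)"
    using restrict_time_measurable[OF less_imp_le[OF T] w_meas] B B0 by (intro kern.admissibleI[where B=B]) (simp_all add: restrict_time_def)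
  have wB: "\<bar>restrict_time T w r z\<bar> \<le> B" for r z using B[of r z] B0 by (auto simp: restrict_time_def)

  \<comment> \<open>The set of integration in the equation contains \<open>s = 0\<close>, where nothing is known about the law of \<open>Xt\<close>; this is a null set.\<close>
  have operator: "(LINT s:{0..t}|lborel. (LINT y|S s. V (t - s) (x - y) * v (t - s) (x - y))) = kern.K (restrict_time T v) t x"
    if v: "(\<lambda>(t, x). v t x) \<in> borel_measurable (restrict_space borel {0..T} \<Otimes>\<^sub>M borel)" and t: "t \<in> {0..T}" for v t x
    unfolding set_lebesgue_integral_def kern.K_def
  proof (rule integral_discrete_difference[where X="{0}"])
    fix s :: real assume "s \<notin> {0}"
    show "indicator {0..t} s *\<^sub>R (LINT y|S s. V (t - s) (x - y) * v (t - s) (x - y)) = m s * kern.avg (restrict_time T v) t x s"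
    proof (cases "0 < s \<and> s \<le> t")
      case True
      then have s: "0 < s" "s \<le> T" "t - s \<in> {0..T}" using t by auto
      define g where "g y = restrict_time T V (t - s) y * restrict_time T v (t - s) y" for y
      have [measurable]: "g \<in> borel_measurable borel"
        using measurable_Pair2[OF restrict_time_measurable[OF less_imp_le[OF T] v], of "t - s"]
          measurable_Pair2[OF kern.V_meas, of "t - s"]
        unfolding g_def by simp
      have "(LINT y|S s. g (x - y)) = measure (S s) UNIV * (LINT \<omega>|M0. g (x + Xt s \<omega>))"
        using s by (intro integral_by_normalised_law B_space S_sets S_fin S_pos B_law
            process_coordinate_measurable[OF B_meas]) auto
      moreover have "Y s = Xt s" using s by (auto simp: Y_def from_zero_def)
      ultimately show ?thesis using s True by (simp add: g_def restrict_time_eq kern.avg_def m_def)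
    next
      case False
      then have "s < 0 \<or> t < s" using \<open>s \<notin> {0}\<close> by auto
      then show ?thesis by (auto simp: kern.m_out kern.avg_out)
    qed
  qed auto

  have u_eq: "u t x = kern.solution (restrict_time T w) t x" if t: "t \<in> {0..T}" for t x
  proof -
    from P_copies[of x] obtain F where F: "\<And>i. subalgebra (P x) (F i)"
      "prob_space.indep_sets (P x) (\<lambda>i. sets (F i)) UNIV"
      "\<And>t. 0 \<le> t \<Longrightarrow> N t \<in> measurable (F 0) (count_space UNIV)"
      "\<And>i. 1 \<le> i \<Longrightarrow> jointly_measurable_process (F i) (Xc i)"
      "\<And>i. 1 \<le> i \<Longrightarrow> process_law (P x) (Xc i) = process_law M0 Xt"
      unfolding iid_copies_indep_of_def by blast
    have sp: "space (P x) = space \<Omega>" by (rule sets_eq_imp_space_eq[OF P_sets])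
    interpret Px: prob_space "P x" by (rule P_prob)
    interpret walk: marked_walk "P x" F N \<tau> M0 Y m "restrict_time T V" T Cm Cv "\<lambda>i. from_zero (Xc i)" t
    proof (unfold_locales)
      show "jump_times (space (P x)) N \<tau>" unfolding sp by (rule jumps)
      show "(\<lambda>(s, \<omega>). from_zero (Xc i) s \<omega>) \<in> borel_measurable (borel \<Otimes>\<^sub>M F i)" if "1 \<le> i" for i
        by (rule from_zero_measurable[OF F(4)[OF that]])
      show "distr (P x) borel (from_zero (Xc i) s) = distr M0 borel (Y s)" if "1 \<le> i" for i s
        unfolding Y_def
        by (rule distr_from_zero_eq[OF P_prob B_space
              measurable_from_subalg[OF F(1) process_coordinate_measurable[OF F(4)[OF that]]]
              process_coordinate_measurable[OF B_meas] F(5)[OF that]])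
    qed (use F P_poisson t in auto)
    \<comment> \<open>At the jump times the concatenated path is the walk: the increment from \<open>\<tau> n\<close> to \<open>\<tau> (Suc n)\<close> is the copy number \<open>Suc n\<close> run for the whole gap.\<close>
    have place: "walk.place (X 0) n \<omega> = X (\<tau> n \<omega>) \<omega>" if \<omega>: "\<omega> \<in> space (P x)" for n \<omega>
    proof (induction n)
      case 0
      then show ?case using walk.\<tau>_0[OF \<omega>] by simp
    next
      case (Suc n)
      have "X (\<tau> (Suc n) \<omega>) \<omega> = X (\<tau> n \<omega>) \<omega> + Xc (Suc n) (\<tau> (Suc n) \<omega> - \<tau> n \<omega>) \<omega>"
        using X_constr \<omega> walk.\<tau>_less[OF \<omega>, of n "Suc n"] by (simp add: concatenated_at_def sp)
      moreover have "from_zero (Xc (Suc n)) (walk.gap n \<omega>) \<omega> = Xc (Suc n) (\<tau> (Suc n) \<omega> - \<tau> n \<omega>) \<omega>"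
        using walk.gap_pos[OF \<omega>, of n] by (simp add: from_zero_def walk.gap_def)
      ultimately show ?case using Suc by simp
    qed
    have "u t x = exp t * (LINT \<omega>|P x. restrict_time T w (t - \<tau> (N t \<omega>) \<omega>) (walk.place (X 0) (N t \<omega>) \<omega>) *
        walk.weight (X 0) (N t \<omega>) \<omega>)"
      unfolding u_def[OF t]
    proof (intro arg_cong[where f="\<lambda>I. exp t * I"] Bochner_Integration.integral_cong refl)
      fix \<omega> assume \<omega>: "\<omega> \<in> space (P x)"
      have before: "0 \<le> \<tau> i \<omega>" "\<tau> i \<omega> \<le> t" if "i \<le> N t \<omega>" for i
        using walk.\<tau>_nonneg[OF \<omega>] walk.\<tau>_le_iff[OF \<omega>, of t i] that t by auto
      have "walk.weight (X 0) (N t \<omega>) \<omega> =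
          (\<Prod>i=1..N t \<omega>. measure (S (\<tau> i \<omega> - \<tau> (i - 1) \<omega>)) UNIV * V (t - \<tau> i \<omega>) (X (\<tau> i \<omega>) \<omega>))"
        unfolding walk.weight_eq_prod
      proof (rule prod.cong[OF refl])
        fix i assume i: "i \<in> {1..N t \<omega>}"
        have "\<tau> (i - 1) \<omega> < \<tau> i \<omega>" using i by (intro walk.\<tau>_less[OF \<omega>]) auto
        then show "m (\<tau> i \<omega> - \<tau> (i - 1) \<omega>) * restrict_time T V (t - \<tau> i \<omega>) (walk.place (X 0) i \<omega>) =
            measure (S (\<tau> i \<omega> - \<tau> (i - 1) \<omega>)) UNIV * V (t - \<tau> i \<omega>) (X (\<tau> i \<omega>) \<omega>)"
          using before[of i] walk.\<tau>_nonneg[OF \<omega>, of "i - 1"] i t by (simp add: m_def restrict_time_def place[OF \<omega>])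
      qed
      moreover have "t - \<tau> (N t \<omega>) \<omega> \<in> {0..T}" using before[of "N t \<omega>"] t by auto
      ultimately show "w (t - \<tau> (N t \<omega>) \<omega>) (X (\<tau> (N t \<omega>) \<omega>) \<omega>) *
          (\<Prod>i=1..N t \<omega>. measure (S (\<tau> i \<omega> - \<tau> (i - 1) \<omega>)) UNIV * V (t - \<tau> i \<omega>) (X (\<tau> i \<omega>) \<omega>)) =
          restrict_time T w (t - \<tau> (N t \<omega>) \<omega>) (walk.place (X 0) (N t \<omega>) \<omega>) * walk.weight (X 0) (N t \<omega>) \<omega>"
        by (simp add: restrict_time_eq place[OF \<omega>])
    qed
    also have "\<dots> = kern.solution (restrict_time T w) t x"
    proof (rule walk.walk_from_start_represents_solution[OF w _ wB _ P_start])
      show "X 0 \<in> borel_measurable (P x)" using X0_meas by (simp cong: measurable_cong_sets[OF P_sets])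
    qed (simp add: restrict_time_def)
    finally show ?thesis .
  qed

  let ?U = "kern.solution (restrict_time T w)"
  have U: "kern.admissible ?U" by (rule kern.admissible_solution[OF w wB])
  have u_meas: "(\<lambda>(t, x). u t x) \<in> borel_measurable (restrict_space borel {0..T} \<Otimes>\<^sub>M borel)"
  proof -
    have "(\<lambda>q. (fst q, snd q)) \<in> measurable (restrict_space borel {0..T} \<Otimes>\<^sub>M borel) (borel \<Otimes>\<^sub>M borel)"
      by (intro measurable_Pair measurable_compose[OF measurable_fst] measurable_restrict_space1) auto
    from measurable_compose[OF this kern.admissible_measurable[OF U]]
    have "(\<lambda>(t, x). ?U t x) \<in> borel_measurable (restrict_space borel {0..T} \<Otimes>\<^sub>M (borel :: (real ^ 'd) measure))"
      by (simp add: case_prod_beta')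
    moreover have "(\<lambda>(t, x). u t x) q = (\<lambda>(t, x). ?U t x) q" if "q \<in> space (restrict_space borel {0..T} \<Otimes>\<^sub>M borel)" for q
      using that by (auto simp: space_pair_measure space_restrict_space u_eq)
    ultimately show ?thesis by (subst measurable_cong) auto
  qed
  have "bounded_solution T S V w u"
    unfolding bounded_solution_def
  proof (intro conjI ballI allI u_meas)
    obtain C where C: "\<And>r z. r \<le> T \<Longrightarrow> \<bar>?U r z\<bar> \<le> C" using U by (auto simp: kern.admissible_def)
    show "bdd_above ((\<lambda>(t, x). \<bar>u t x\<bar>\<^sup>2) ` ({0..T} \<times> UNIV))"
    proof (rule bdd_aboveI2)
      fix q :: "real \<times> (real ^ 'd)" assume "q \<in> {0..T} \<times> UNIV"
      then obtain t x where q: "q = (t, x)" "t \<in> {0..T}" by auto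
      then have "\<bar>u t x\<bar> \<le> C" using C by (simp add: u_eq)
      from power_mono[OF this abs_ge_zero] show "(case q of (t, x) \<Rightarrow> \<bar>u t x\<bar>\<^sup>2) \<le> C\<^sup>2"
        by (simp only: q prod.case)
    qed
    fix t x assume t: "t \<in> {0..T}"
    have "kern.K (restrict_time T u) t x = kern.K ?U t x"
      using t by (intro kern.K_cong) (auto simp: restrict_time_def u_eq)
    then show "u t x = w t x + (LINT s:{0..t}|lborel. (LINT y|S s. V (t - s) (x - y) * u (t - s) (x - y)))"
      using kern.solution_fixed_point[OF w wB, of t x] t by (simp add: operator[OF u_meas] u_eq restrict_time_eq)
  qed
  moreover have "v t x = u t x" if v: "bounded_solution T S V w v" and t: "t \<in> {0..T}" for v t x
  proof -
    have v_meas: "(\<lambda>(t, x). v t x) \<in> borel_measurable (restrict_space borel {0..T} \<Otimes>\<^sub>M borel)"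
      and v_eq: "\<And>t x. t \<in> {0..T} \<Longrightarrow> v t x = w t x +
        (LINT s:{0..t}|lborel. (LINT y|S s. V (t - s) (x - y) * v (t - s) (x - y)))"
      using v by (auto simp: bounded_solution_def)
    from v obtain C where C: "\<And>t x. t \<in> {0..T} \<Longrightarrow> \<bar>v t x\<bar>\<^sup>2 \<le> C"
      unfolding bounded_solution_def bdd_above_def by fastforce
    have "kern.admissible (restrict_time T v)"
    proof (rule kern.admissibleI[OF restrict_time_measurable[OF less_imp_le[OF T] v_meas]])
      show "\<bar>restrict_time T v r z\<bar> \<le> sqrt C" for r z
      proof (cases "r \<in> {0..T}")
        case True
        then show ?thesis using real_le_rsqrt[OF C[OF True]] by (simp add: restrict_time_eq)
      next
        case False
        have "0 \<le> C" using order_trans[OF zero_le_power2 C[of 0 z]] T by simp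
        then show ?thesis using False by (auto simp: restrict_time_def)
      qed
    qed
    then have "restrict_time T v t x = ?U t x"
      by (rule kern.solution_unique[OF w wB]) (use t v_eq operator[OF v_meas] in \<open>auto simp: restrict_time_eq\<close>)
    then show ?thesis using t by (simp add: restrict_time_eq u_eq)
  qed
  ultimately show ?thesis by (auto simp: the_bounded_solution_def)
qed

end
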